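(* Let $n$ be an integer with $3\mid n$ and $n\not\equiv 12 \pmod{27}$. Let $\rho$ be a root of $f_n(X)=X^3-nX^2-(n+3)X-1$, let $L_n=\mathbb{Q}(\rho)$ with Galois group $G=\mathrm{Gal}(L_n/\mathbb{Q})$ and ring of integers $\mathcal{O}_{L_n}$, let $\sigma$ be the generator of $G$ with $\sigma(\rho)=-1/(1+\rho)$, and put $\rho'=\sigma(\rho)$. Write $n^2+3n+9=de^2c^3$ with $d,e,c\in\mathbb{Z}_{>0}$, where $d$ and $e$ are square-free and $(d,e)=1$. Let $\zeta=\zeta_3$ be a primitive cube root of unity and $A_n=n+3(1+\zeta)$. Let $a_0$ and $a_1$ be integers that satisfy \[ ec=\begin{cases} a_0^2-a_0a_1+a_1^2 & \text{if } n\equiv 3\pmod 9 \text{ and } n\not\equiv 12\pmod{27},\\ 3(a_0^2-a_0a_1+a_1^2) & \text{if } n\equiv 0,6 \pmod 9,\end{cases} \] and $a_0+a_1\zeta \mid A_n$ in $\mathbb{Z}[\zeta]$. Put \[ \alpha:=\frac{1}{ec^2}\bigl(3a_0\rho+3a_1\rho'-n(a_0+a_1)\bigr). \] Then \[ \mathcal{O}_{L_n}=\mathbb{Z}[G]\cdot\alpha\oplus\mathbb{Z}=\mathcal{A}_{L_n/\mathbb{Q}}\cdot(\alpha+1), \] where $\mathcal{A}_{L_n/\mathbb{Q}}=\{x\in\mathbb{Q}[G] \mid x\cdot\mathcal{O}_{L_n}\subset\mathcal{O}_{L_n}\}$ is the associated order.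
   Context: For every integer $n$ the polynomial $f_n(X)=X^3-nX^2-(n+3)X-1$ (Shanks' cubic polynomial) is irreducible over $\mathbb{Q}$, and $L_n=\mathbb{Q}(\rho)$, for $\rho$ a root of $f_n$, is a cyclic cubic field (a simplest cubic field); $G$ has a generator $\sigma$ with $\sigma(\rho)=-1/(1+\rho)$. The group ring $\mathbb{Q}[G]$ acts on $L_n$ by $x\cdot a=\sum_{g\in G} n_g\, g(a)$ for $x=\sum_{g\in G} n_g g\in\mathbb{Q}[G]$ and $a\in L_n$. The direct sum is an internal direct sum of subgroups of $\mathcal{O}_{L_n}$. Under the hypothesis $3\mid n$, $n\not\equiv 12\pmod{27}$, exactly one of the two cases in the displayed condition on $ec$ occurs. *)

theory Defs
  imports
    "HOL-Algebra.Algebraic_Closure_Type"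
    "HOL-Algebra.Bij"
    "HOL-Algebra.Generated_Fields"
    "HOL-Algebra.Generated_Groups"
    "HOL-Number_Theory.Cong"
begin

text \<open>Number fields are taken as subfields of the complex numbers.\<close>

definition complex_on :: "complex set \<Rightarrow> complex ring" where
  "complex_on S = (ring_of_type_algebra :: complex ring)\<lparr>carrier := S\<rparr>"

text \<open>Every subfield of the complex numbers contains the rationals, so the subfield generated
  by \<open>x\<close> is \<open>\<rat>(x)\<close>, and likewise the generated unital subring is \<open>\<int>[x]\<close>.\<close>

definition rat_adjoin :: "complex \<Rightarrow> complex set" where
  "rat_adjoin x = generate_field (complex_on UNIV) {x}"

definition int_adjoin :: "complex \<Rightarrow> complex set" where
  "int_adjoin x = generate_ring (complex_on UNIV) {x}"

definition ring_of_integers :: "complex set \<Rightarrow> complex set" where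
  "ring_of_integers L = {x \<in> L. algebraic_int x}"

text \<open>Members of \<open>Bij L\<close> are extensional, so each automorphism of \<open>L\<close> is represented by exactly
  one HOL function; its values outside \<open>L\<close> are \<open>undefined\<close>. The group operation is composition
  on \<open>L\<close>.\<close>

definition galois_group :: "complex set \<Rightarrow> complex set \<Rightarrow> (complex \<Rightarrow> complex) monoid" where
  "galois_group F L = (BijGroup L)
     \<lparr>carrier := {g \<in> Bij L. g \<in> ring_hom (complex_on L) (complex_on L) \<and> (\<forall>x\<in>F. g x = x)}\<rparr>"

text \<open>For a finite group \<open>G\<close>, the element \<open>\<Sum> n\<^sub>g g\<close> of the group ring is represented by its
  coefficient function \<open>g \<mapsto> n\<^sub>g\<close>. The coefficient ring \<open>R\<close> is \<open>\<int>\<close> or \<open>\<rat>\<close>, both as subsets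
  of the complex numbers. Only the underlying set and the action on \<open>L\<close> are needed.\<close>

definition group_ring ::
    "complex set \<Rightarrow> (complex \<Rightarrow> complex) monoid \<Rightarrow> ((complex \<Rightarrow> complex) \<Rightarrow> complex) set" where
  "group_ring R G = (carrier G \<rightarrow>\<^sub>E R)"

definition group_ring_act ::
    "(complex \<Rightarrow> complex) monoid \<Rightarrow> ((complex \<Rightarrow> complex) \<Rightarrow> complex) \<Rightarrow> complex \<Rightarrow> complex" where
  "group_ring_act G x a = (\<Sum>g\<in>carrier G. x g * g a)"

definition associated_order :: "complex set \<Rightarrow> ((complex \<Rightarrow> complex) \<Rightarrow> complex) set" where
  "associated_order L =
     {x \<in> group_ring \<rat> (galois_group \<rat> L).
        group_ring_act (galois_group \<rat> L) x ` ring_of_integers L \<subseteq> ring_of_integers L}"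

definition internal_direct_sum :: "('a, 'b) ring_scheme \<Rightarrow> 'a set \<Rightarrow> 'a set \<Rightarrow> bool" where
  "internal_direct_sum M A B \<longleftrightarrow>
     additive_subgroup A M \<and> additive_subgroup B M \<and>
     carrier M = A <+>\<^bsub>M\<^esub> B \<and> A \<inter> B = {\<zero>\<^bsub>M\<^esub>}"

end

theory Submission
  imports Defs "Jordan_Normal_Form.Char_Poly"
begin

text \<open>The trace-zero part of \<open>L\<close> is a line over \<open>\<rat>(\<zeta>)\<close>, with \<open>\<sigma>\<close> acting as \<open>\<zeta>\<close>, spanned by
  \<open>\<theta> = 3 \<rho> - n\<close>; an element \<open>u \<cdot> \<theta>\<close> has characteristic polynomial
  \<open>X\<^sup>3 - 3 \<Delta> N(u) X - \<Delta> Tr(u\<^sup>3 A')\<close>, where \<open>\<Delta> = n\<^sup>2 + 3 n + 9\<close> is the norm of \<open>A = n + 3 (1 + \<zeta>)\<close> and \<open>A'\<close>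
  is its conjugate. The choice of \<open>a\<^sub>0 + a\<^sub>1 \<zeta>\<close> turns this, for \<open>u \<cdot> \<alpha>\<close>, into
  \<open>X\<^sup>3 - 3 D N(u) X - D Tr(u\<^sup>3 B)\<close> with \<open>D\<close> square-free, prime to \<open>6\<close>, and \<open>N(B) = D\<close>. So \<open>\<alpha>\<close> is integral,
  and a prime \<open>p\<close> in the denominator of an integral \<open>u \<cdot> \<alpha>\<close> is excluded by the linear coefficient
  if \<open>p\<close> does not divide \<open>3 D\<close> and by the constant one otherwise; at \<open>p = 3\<close> this uses that
  \<open>B\<close> is not congruent to an integer modulo \<open>3\<close>, which is where \<open>n \<noteq> 12\<close> modulo \<open>27\<close> enters. The same
  argument shows that an integral element has its rational part in \<open>\<int>\<close>.\<close>

subsection \<open>Closure properties of algebraic integers\<close>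

text \<open>\<open>L\<close> does not contain \<zeta>, so Z[\<zeta>] is kept apart from the complex
  numbers as the type \<open>eis\<close> of coordinate pairs; it meets \<open>L\<close> only in
  coordinates with respect to \<open>\<theta>\<close> and \<open>\<theta>1\<close>. The complex
  \<zeta> of the theorem enters through the divisibility hypothesis alone. No prime factorization in
  Z[\<zeta>] is used: divisibility by rational integers is read off from coordinates, norms and
  traces.

  Away from 3, N(a) = e c makes \<Delta> N(a) / (e c^2)^2 equal to d e, which explains D. If A = a b
  and bars denote conjugates, then a^3 times the conjugate of A is N(a) times a^2 bar(b); the latter
  is divisible by e c^2 because A and bar(A) are coprime at the primes of e c, and the quotient is
  B. At 3, the two cases for e c record whether 3 divides c or e.

  Necessary conditions for integrality come from symmetric functions of conjugates, so sums and
  products of algebraic integers have to be known to be integral.\<close>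

lemma algebraic_int_if_int_eigenvector:
  fixes M :: "int mat" and z :: complex
  assumes M: "M \<in> carrier_mat n n" and v: "v \<in> carrier_vec n" "v \<noteq> 0\<^sub>v n"
    and ev: "map_mat of_int M *\<^sub>v v = z \<cdot>\<^sub>v v"
  shows "algebraic_int z"
proof -
  have M': "map_mat of_int M \<in> carrier_mat n n"
    using M by simp
  have "eigenvalue (map_mat of_int M) z"
    unfolding eigenvalue_def eigenvector_def using M' v ev by auto
  then have "poly (char_poly (map_mat of_int M)) z = 0"
    using eigenvalue_root_char_poly[OF M', of z] by blast
  then have "poly (map_poly of_int (char_poly M)) z = 0"
    by (simp add: of_int_hom.char_poly_hom[OF M])
  then show ?thesis
    using degree_monic_char_poly[OF M] by (auto simp: algebraic_int_altdef_ipoly)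
qed

global_interpretation zmod: Modules.module "\<lambda>(k::int) (z::complex). of_int k * z"
  defines zspan = zmod.span
  by unfold_locales (auto simp: algebra_simps)

lemma zspan_mult_closed:
  assumes "\<And>s. s \<in> S \<Longrightarrow> z * s \<in> zspan S" and "t \<in> zspan S"
  shows "z * t \<in> zspan S"
  using assms(2)
proof (induction rule: zmod.span_induct_alt)
  case base
  show ?case by (simp add: zmod.span_zero)
next
  case (step k x y)
  have "z * (of_int k * x + y) = of_int k * (z * x) + z * y"
    by (simp add: algebra_simps)
  with step assms(1) show ?case
    by (simp add: zmod.span_add zmod.span_scale)
qed

text \<open>Determinant trick: z acts on the finitely generated group through an integer matrix, and
  the vector that lists S is an eigenvector; \<open>s0\<close> keeps that vector from being
  zero.\<close>

lemma algebraic_int_if_preserves_zspan: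
  assumes fin: "finite S" and s0: "s0 \<in> S" "s0 \<noteq> 0"
    and closed: "\<And>s. s \<in> S \<Longrightarrow> z * s \<in> zspan S"
  shows "algebraic_int z"
proof -
  obtain xs where xs: "set xs = S" "distinct xs"
    using finite_distinct_list[OF fin] by blast
  define n where "n = length xs"
  have "\<exists>u. z * s = (\<Sum>t\<in>S. of_int (u t) * t)" if "s \<in> S" for s
    using closed[OF that] unfolding zmod.span_finite[OF fin] by auto
  then obtain u where u: "z * s = (\<Sum>t\<in>S. of_int (u s t) * t)" if "s \<in> S" for s
    by metis
  define M where "M = mat n n (\<lambda>(i, j). u (xs ! i) (xs ! j))"
  define v where "v = vec n (\<lambda>i. xs ! i)"
  have "(map_mat of_int M *\<^sub>v v) $ i = (z \<cdot>\<^sub>v v) $ i" if "i < n" for i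
  proof -
    have "(map_mat of_int M *\<^sub>v v) $ i = (\<Sum>j = 0..<n. of_int (u (xs ! i) (xs ! j)) * xs ! j)"
      using that by (simp add: M_def v_def scalar_prod_def)
    also have "\<dots> = (\<Sum>t\<in>S. of_int (u (xs ! i) t) * t)"
      using xs by (intro sum.reindex_bij_betw[where h = "(!) xs"])
        (auto simp: n_def intro!: bij_betw_nth)
    also have "\<dots> = z * xs ! i"
      using u[of "xs ! i"] that xs nth_mem[of i xs] by (simp add: n_def)
    finally show ?thesis
      using that by (simp add: v_def)
  qed
  then have ev: "map_mat of_int M *\<^sub>v v = z \<cdot>\<^sub>v v"
    by (intro eq_vecI) (auto simp: M_def v_def)
  obtain i where "i < n" "xs ! i = s0"
    using s0 xs unfolding n_def in_set_conv_nth[symmetric] by (metis in_set_conv_nth)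
  then have "v \<noteq> 0\<^sub>v n"
    using s0 by (metis v_def index_vec index_zero_vec(1))
  then show ?thesis
    using ev by (intro algebraic_int_if_int_eigenvector[of M n v]) (auto simp: M_def v_def)
qed

lemma algebraic_int_power_in_zspan:
  assumes "algebraic_int x"
  obtains m where "m > 0" "x ^ m \<in> zspan ((\<lambda>i. x ^ i) ` {..<m})"
proof -
  obtain p where p: "poly (map_poly of_int p) x = 0" "lead_coeff p = (1 :: int)"
    using assms by (auto simp: algebraic_int_altdef_ipoly)
  define m where "m = degree p"
  have "m > 0"
  proof (rule ccontr)
    assume "\<not> m > 0"
    then have "p = 1"
      using p(2) by (metis degree_0_id gr0I m_def one_poly_eq_simps(1) pCons_one)
    with p(1) show False by simp
  qed
  have "0 = (\<Sum>i\<le>m. of_int (coeff p i) * x ^ i)"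
    using p(1) by (simp add: poly_altdef m_def degree_map_poly coeff_map_poly)
  also have "\<dots> = (\<Sum>i<m. of_int (coeff p i) * x ^ i) + x ^ m"
    using p(2) by (simp add: m_def lessThan_Suc_atMost[symmetric])
  finally have "x ^ m = (\<Sum>i<m. of_int (- coeff p i) * x ^ i)"
    by (simp add: sum_negf eq_neg_iff_add_eq_0 add.commute)
  also have "\<dots> \<in> zspan ((\<lambda>i. x ^ i) ` {..<m})"
    by (intro zmod.span_sum zmod.span_scale zmod.span_base) auto
  finally show ?thesis
    using that \<open>m > 0\<close> by blast
qed

text \<open>The monomials \<open>x ^ i * y ^ j\<close> below the two degrees span a group stable
  under x and under y, since an exponent that reaches its bound is lowered by the monic equation.
  Hence the group is stable under the sum and the product.\<close>

lemma
  fixes x y :: complex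
  assumes x: "algebraic_int x" and y: "algebraic_int y"
  shows algebraic_int_plus: "algebraic_int (x + y)"
    and algebraic_int_times: "algebraic_int (x * y)"
proof -
  obtain m where m: "m > 0" "x ^ m \<in> zspan ((\<lambda>i. x ^ i) ` {..<m})"
    using algebraic_int_power_in_zspan[OF x] by blast
  obtain k where k: "k > 0" "y ^ k \<in> zspan ((\<lambda>i. y ^ i) ` {..<k})"
    using algebraic_int_power_in_zspan[OF y] by blast
  define S where "S = (\<lambda>(i, j). x ^ i * y ^ j) ` ({..<m} \<times> {..<k})"
  have base: "x ^ i * y ^ j \<in> zspan S" if "i < m" "j < k" for i j
    unfolding S_def using that by (intro zmod.span_base) auto
  have scaled: "w * t \<in> zspan S" if "t \<in> zspan T" "\<And>t. t \<in> T \<Longrightarrow> w * t \<in> zspan S" for w t T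
    using that(1)
  proof (induction rule: zmod.span_induct_alt)
    case (step c a b)
    have "w * (of_int c * a + b) = of_int c * (w * a) + w * b"
      by (simp add: algebra_simps)
    with step that(2) show ?case
      by (simp add: zmod.span_add zmod.span_scale)
  qed (simp add: zmod.span_zero)
  have xS: "x * s \<in> zspan S" if "s \<in> S" for s
  proof -
    obtain i j where ij: "i < m" "j < k" "s = x ^ i * y ^ j"
      using \<open>s \<in> S\<close> by (auto simp: S_def)
    show ?thesis
    proof (cases "Suc i = m")
      case True
      have "y ^ j * x ^ m \<in> zspan S"
        using m(2) by (rule scaled) (use base ij in \<open>auto simp: mult.commute\<close>)
      then show ?thesis
        unfolding ij(3) True[symmetric] by (simp add: mult_ac)
    next
      case False
      then show ?thesis
        using base[of "Suc i" j] ij by (simp add: mult.assoc)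
    qed
  qed
  have yS: "y * s \<in> zspan S" if "s \<in> S" for s
  proof -
    obtain i j where ij: "i < m" "j < k" "s = x ^ i * y ^ j"
      using \<open>s \<in> S\<close> by (auto simp: S_def)
    show ?thesis
    proof (cases "Suc j = k")
      case True
      have "x ^ i * y ^ k \<in> zspan S"
        using k(2) by (rule scaled) (use base ij in auto)
      then show ?thesis
        unfolding ij(3) True[symmetric] by (simp add: mult_ac)
    next
      case False
      then show ?thesis
        using base[of i "Suc j"] ij by (simp add: mult.left_commute)
    qed
  qed
  have S: "finite S" "1 \<in> S"
    using m(1) k(1) by (force simp: S_def)+
  show "algebraic_int (x + y)"
    by (rule algebraic_int_if_preserves_zspan[OF S(1,2)])
      (auto simp: distrib_right intro: zmod.span_add xS yS)
  have "x * y * s \<in> zspan S" if "s \<in> S" for s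
    using zspan_mult_closed[OF xS yS[OF that]] by (simp add: mult.assoc)
  then show "algebraic_int (x * y)"
    by (intro algebraic_int_if_preserves_zspan[OF S(1,2)]) auto
qed

subsection \<open>Eisenstein integers\<close>

text \<open>\<open>Eis r s\<close> stands for r + s \<zeta> with \<zeta>^2 = -1 - \<zeta>; so
  \<open>re\<close> and \<open>im\<close> are coordinates in the basis 1, \<zeta>, not real and
  imaginary parts.\<close>

datatype eis = Eis (re: int) (im: int)

lemma eis_eq_iff: "x = y \<longleftrightarrow> re x = re y \<and> im x = im y"
  by (cases x; cases y) simp

instantiation eis :: comm_ring_1
begin
definition "0 = Eis 0 0"
definition "1 = Eis 1 0"
definition "- x = Eis (- re x) (- im x)"
definition "x + y = Eis (re x + re y) (im x + im y)"
definition "x - y = Eis (re x - re y) (im x - im y)"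
definition "x * y = Eis (re x * re y - im x * im y) (re x * im y + im x * re y - im x * im y)"
instance
  by standard (auto simp: eis_eq_iff zero_eis_def one_eis_def uminus_eis_def plus_eis_def
      minus_eis_def times_eis_def algebra_simps)
end

lemma eis_sel [simp]:
  "re 0 = 0" "im 0 = 0" "re 1 = 1" "im 1 = 0"
  "re (- x) = - re x" "im (- x) = - im x"
  "re (x + y) = re x + re y" "im (x + y) = im x + im y"
  "re (x - y) = re x - re y" "im (x - y) = im x - im y"
  "re (x * y) = re x * re y - im x * im y"
  "im (x * y) = re x * im y + im x * re y - im x * im y"
  by (simp_all add: zero_eis_def one_eis_def uminus_eis_def plus_eis_def minus_eis_def
      times_eis_def)

lemma of_nat_eis: "of_nat k = Eis (int k) 0"
  by (induction k) (simp_all add: eis_eq_iff)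

lemma of_int_eis: "of_int k = Eis k 0"
  by (cases k rule: int_cases2) (simp_all add: of_nat_eis eis_eq_iff)

lemma of_int_eis_sel [simp]: "re (of_int k) = k" "im (of_int k) = 0"
  by (simp_all add: of_int_eis)

lemma numeral_eis_sel [simp]: "re (numeral k) = numeral k" "im (numeral k) = 0"
  using of_int_eis_sel[of "numeral k"] by simp_all

definition ecnj :: "eis \<Rightarrow> eis" where
  "ecnj x = Eis (re x - im x) (- im x)"

lemma ecnj_sel [simp]: "re (ecnj x) = re x - im x" "im (ecnj x) = - im x"
  by (simp_all add: ecnj_def)

lemma ecnj_hom:
  "ecnj (x + y) = ecnj x + ecnj y" "ecnj (x * y) = ecnj x * ecnj y" "ecnj (of_int k) = of_int k"
  "ecnj (ecnj x) = x" "ecnj (- x) = - ecnj x" "ecnj (numeral w) = numeral w"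
  by (simp_all add: eis_eq_iff algebra_simps)

definition enorm :: "eis \<Rightarrow> int" where
  "enorm x = re x ^ 2 - re x * im x + im x ^ 2"

definition etr :: "eis \<Rightarrow> int" where
  "etr x = 2 * re x - im x"

lemma mult_ecnj: "x * ecnj x = of_int (enorm x)"
  by (simp add: eis_eq_iff enorm_def power2_eq_square algebra_simps)

lemma add_ecnj: "x + ecnj x = of_int (etr x)"
  by (simp add: eis_eq_iff etr_def)

lemma enorm_mult: "enorm (x * y) = enorm x * enorm y"
  by (simp add: enorm_def power2_eq_square algebra_simps)

lemma enorm_of_int: "enorm (of_int k) = k ^ 2"
  by (simp add: enorm_def)

lemma enorm_ecnj: "enorm (ecnj x) = enorm x"
  by (simp add: enorm_def power2_eq_square algebra_simps)

lemma enorm_power: "enorm (x ^ k) = enorm x ^ k"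
proof (induction k)
  case (Suc k)
  then show ?case by (simp add: enorm_mult)
qed (simp add: enorm_def)

lemma of_int_dvd_eis_iff: "of_int k dvd x \<longleftrightarrow> k dvd re x \<and> k dvd im x"
proof
  assume "k dvd re x \<and> k dvd im x"
  then obtain u v where "re x = k * u" "im x = k * v"
    by (auto elim!: dvdE)
  then have "x = of_int k * Eis u v"
    by (simp add: eis_eq_iff)
  then show "of_int k dvd x"
    by simp
qed (auto elim!: dvdE)

lemma of_int_mult_eis_cancel: "of_int k * x = of_int k * y \<longleftrightarrow> k = 0 \<or> x = (y :: eis)"
  by (auto simp: eis_eq_iff)

lemma of_int_dvd_of_int_mult_eis_cancel:
  assumes "coprime k l" and "of_int k dvd of_int l * x"
  shows "of_int k dvd (x :: eis)"
  using assms by (simp add: of_int_dvd_eis_iff coprime_dvd_mult_right_iff)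

text \<open>With \<open>T\<close> the trace of \<open>a b\<close>, multiplying \<open>a\<^sup>2 (ecnj b)\<close> by \<open>T\<^sup>2\<close> produces only
  multiples of \<open>e c\<^sup>2\<close>.\<close>

lemma eis_cube_split:
  fixes a b :: eis and d e c :: int
  assumes Na: "enorm a = e * c" and Nb: "enorm b = d * e * c ^ 2"
    and cop: "coprime (etr (a * b)) (e * c)" and pos: "e > 0" "c > 0"
  obtains B where "a ^ 2 * ecnj b = of_int (e * c ^ 2) * B" "enorm B = d * e"
proof -
  define T where "T = etr (a * b)"
  have T: "of_int T = a * b + ecnj a * ecnj b"
    using add_ecnj[of "a * b"] by (simp add: T_def ecnj_hom)
  have Na': "a * ecnj a = of_int e * of_int c" and Nb': "b * ecnj b = of_int d * of_int e * of_int c ^ 2"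
    using mult_ecnj[of a] mult_ecnj[of b] by (simp_all add: Na Nb)
  define w where "w = a ^ 2 * ecnj b"
  \<comment> \<open>Multiplying by T = a b + bar(a) bar(b) splits off b bar(b), already a multiple
    of e c^2, and a bar(a), only a multiple of e c. A second factor T supplies what is missing in
    the latter term.\<close>
  have "of_int T * w = a ^ 3 * (b * ecnj b) + (a * ecnj a) * (a * ecnj b ^ 2)"
    by (simp add: w_def T power2_eq_square power3_eq_cube algebra_simps)
  then have "of_int T * (of_int T * w) = of_int T * (a ^ 3 * (b * ecnj b) + (a * ecnj a) * (a * ecnj b ^ 2))"
    by simp
  then have "of_int (T ^ 2) * w = of_int T * a ^ 3 * (b * ecnj b)
      + (a * ecnj a) * (of_int T * (a * ecnj b ^ 2))"
    by (simp add: power2_eq_square algebra_simps)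
  also have "of_int T * (a * ecnj b ^ 2) = (b * ecnj b) * (a ^ 2 * ecnj b) + (a * ecnj a) * ecnj b ^ 3"
    by (simp add: T power2_eq_square power3_eq_cube algebra_simps)
  also have "of_int T * a ^ 3 * (b * ecnj b) + (a * ecnj a) *
        ((b * ecnj b) * (a ^ 2 * ecnj b) + (a * ecnj a) * ecnj b ^ 3) = of_int (e * c ^ 2) *
      (of_int e * ecnj b ^ 3 + of_int (d * e) * a ^ 2 * ecnj b * of_int c + of_int d * a ^ 3 * of_int T)"
    unfolding Na' Nb' by (simp add: power2_eq_square algebra_simps)
  finally have "of_int (T ^ 2) * w = of_int (e * c ^ 2) *
      (of_int e * ecnj b ^ 3 + of_int (d * e) * a ^ 2 * ecnj b * of_int c + of_int d * a ^ 3 * of_int T)" .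
  then have "of_int (e * c ^ 2) dvd of_int (T ^ 2) * w"
    by simp
  moreover have "coprime (e * c ^ 2) (T ^ 2)"
    using cop by (simp add: T_def coprime_commute)
  ultimately obtain B where B: "w = of_int (e * c ^ 2) * B"
    using of_int_dvd_of_int_mult_eis_cancel by blast
  have "enorm w = (e * c) ^ 2 * (d * e * c ^ 2)"
    by (simp add: w_def enorm_mult enorm_power enorm_ecnj Na Nb)
  moreover have "enorm w = (e * c ^ 2) ^ 2 * enorm B"
    by (simp add: B enorm_mult enorm_of_int del: of_int_mult of_int_power)
  ultimately have "(e * c ^ 2) ^ 2 * enorm B = (e * c ^ 2) ^ 2 * (d * e)"
    by (simp add: power2_eq_square algebra_simps)
  then have "enorm B = d * e"
    using pos by simp
  with B that show ?thesis
    by (auto simp: w_def)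
qed

text \<open>Modulo 3 cubing is additive, fixes integers by Fermat, and sends \<zeta> to 1.\<close>

lemma eis_cube_mod_3:
  obtains z where "x ^ 3 = of_int (re x + im x) + 3 * (z :: eis)"
proof -
  have cube: "(3 :: int) dvd r ^ 3 - r" for r :: int
  proof -
    have "\<exists>k. r = 3 * k \<or> r = 3 * k + 1 \<or> r = 3 * k + 2"
      by presburger
    then obtain k where "r = 3 * k \<or> r = 3 * k + 1 \<or> r = 3 * k + 2" ..
    moreover have "(3 * k) ^ 3 - 3 * k = 3 * (9 * k ^ 3 - k)"
      "(3 * k + 1) ^ 3 - (3 * k + 1) = 3 * (9 * k ^ 3 + 9 * k ^ 2 + 2 * k)"
      "(3 * k + 2) ^ 3 - (3 * k + 2) = 3 * (9 * k ^ 3 + 18 * k ^ 2 + 11 * k + 2)"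
      by (simp_all add: power2_eq_square power3_eq_cube algebra_simps)
    ultimately show ?thesis
      by (elim disjE) (simp_all only: dvd_triv_left)
  qed
  have "of_int 3 dvd x ^ 3 - of_int (re x + im x)"
    unfolding of_int_dvd_eis_iff
  proof
    have "re (x ^ 3 - of_int (re x + im x)) =
        (re x ^ 3 - re x) + (im x ^ 3 - im x) - 3 * (re x * im x ^ 2)"
      by (simp add: power3_eq_cube power2_eq_square algebra_simps)
    then show "3 dvd re (x ^ 3 - of_int (re x + im x))"
      using cube by (metis dvd_add dvd_diff dvd_triv_left)
    have "im (x ^ 3 - of_int (re x + im x)) = 3 * (re x ^ 2 * im x - re x * im x ^ 2)"
      by (simp add: power3_eq_cube power2_eq_square algebra_simps)
    then show "3 dvd im (x ^ 3 - of_int (re x + im x))"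
      by simp
  qed
  then show ?thesis
    using that by (auto elim!: dvdE simp: algebra_simps)
qed

text \<open>The arithmetic behind maximality at \<open>p\<close>: the hypotheses express integrality of the
  conjugates' elementary symmetric functions of \<open>x / p\<close> and of \<open>x / p + 1\<close>, \<open>x / p + \<zeta>\<close>.\<close>

lemma eis_dvd_if_prime_not_dvd:
  assumes p: "prime (p :: int)" "\<not> p dvd 3" "\<not> p dvd D"
    and N: "\<And>y. y \<in> {0, 1, Eis 0 1} \<Longrightarrow> p ^ 2 dvd 3 * D * enorm (x + of_int p * y)"
  shows "of_int p dvd x"
proof -
  \<comment> \<open>Polarization: comparing the norms of x, x + p and x + p \<zeta> isolates the
    cross terms. They are two linear forms in the coordinates of x whose determinant is 3, which is
    invertible modulo p.\<close>
  have *: "p dvd t" if "p ^ 2 dvd 3 * D * (enorm x + p * t + p ^ 2 * k)" for t k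
  proof -
    have "p ^ 2 dvd 3 * D * (enorm x + p * t + p ^ 2 * k) - 3 * D * enorm x - p ^ 2 * (3 * D * k)"
      using that N[of 0] by (intro dvd_diff) auto
    then have "p * p dvd p * (3 * D * t)"
      by (simp add: algebra_simps power2_eq_square)
    then have "p dvd 3 * D * t"
      using p(1) by (metis dvd_mult_cancel_left prime_elem_not_zeroI prime_imp_prime_elem)
    then show ?thesis
      using p by (simp add: prime_dvd_mult_iff)
  qed
  have 1: "p dvd 2 * re x - im x"
    using N[of 1] by (intro *[of _ 1]) (simp add: enorm_def algebra_simps power2_eq_square)
  have 2: "p dvd 2 * im x - re x"
    using N[of "Eis 0 1"] by (intro *[of _ 1]) (simp add: enorm_def algebra_simps power2_eq_square)
  have "p dvd 2 * (2 * re x - im x) + (2 * im x - re x)"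
    by (intro dvd_add dvd_mult 1 2)
  then have "p dvd 3 * re x" by (simp add: algebra_simps)
  then have r: "p dvd re x"
    using p by (simp add: prime_dvd_mult_iff)
  have "p dvd 2 * (2 * im x - re x) + (2 * re x - im x)"
    by (intro dvd_add dvd_mult 1 2)
  then have "p dvd 3 * im x" by (simp add: algebra_simps)
  then have "p dvd im x"
    using p by (simp add: prime_dvd_mult_iff)
  with r show ?thesis
    by (simp add: of_int_dvd_eis_iff)
qed

text \<open>For w = x^3 B, the trace is divisible by p^2 and the norm by p^4: three factors p come
  from N(x)^3 and one from N(B). The identity 3 \<open>im w\<close>^2 = 4 N(w) - Tr(w)^2 then gives
  p^2 | w. Multiplying by bar(B) costs only one factor p, so p | x^3, and p is unramified in
  Z[\<zeta>].\<close>

lemma eis_dvd_if_prime_dvd: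
  assumes p: "prime (p :: int)" "\<not> p dvd 6" and D: "D = p * k" "\<not> p dvd k"
    and B: "enorm B = D"
    and N: "p ^ 2 dvd 3 * D * enorm x" and Tr: "p ^ 3 dvd D * etr (x ^ 3 * B)"
  shows "of_int p dvd x"
proof -
  have p0: "p \<noteq> 0"
    using p by auto
  have p23: "\<not> p dvd 2" "\<not> p dvd 3"
    using p(2) dvd_trans[of p 2 6] dvd_trans[of p 3 6] by auto
  have "p * p dvd p * (3 * k * enorm x)"
    using N by (simp add: D power2_eq_square algebra_simps)
  then have Nx: "p dvd enorm x"
    using p0 p(1) p23 D(2) by (simp add: prime_dvd_mult_iff)
  define w where "w = x ^ 3 * B"
  have "p * p ^ 2 dvd p * (k * etr w)"
    using Tr by (simp add: D w_def power2_eq_square power3_eq_cube algebra_simps)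
  then have "p ^ 2 dvd k * etr w"
    using p0 by simp
  moreover have "coprime (p ^ 2) k"
    using p(1) D(2) by (simp add: prime_imp_coprime)
  ultimately have Tw: "p ^ 2 dvd etr w"
    by (simp add: coprime_dvd_mult_right_iff)
  have "enorm w = enorm x ^ 3 * (p * k)"
    by (simp add: w_def enorm_mult enorm_power B D)
  then have Nw: "p ^ 4 dvd enorm w"
    using Nx by (auto elim!: dvdE simp: power_mult_distrib eval_nat_numeral)
  have "3 * im w ^ 2 = 4 * enorm w - etr w ^ 2"
    by (simp add: enorm_def etr_def power2_eq_square algebra_simps)
  moreover have "p ^ 4 dvd etr w ^ 2"
    using dvd_power_same[OF Tw, of 2] by simp
  ultimately have "p ^ 4 dvd 3 * im w ^ 2"
    using Nw by simp
  moreover have "coprime (p ^ 4) 3"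
    using p(1) p23 by (simp add: prime_imp_coprime)
  ultimately have "p ^ 4 dvd im w ^ 2"
    by (simp add: coprime_dvd_mult_right_iff)
  then have "(p ^ 2) ^ 2 dvd im w ^ 2" by simp
  then have iw: "p ^ 2 dvd im w"
    by (subst (asm) pow_divides_pow_iff) auto
  then have "p ^ 2 dvd etr w + im w"
    using Tw by simp
  then have "p ^ 2 dvd 2 * re w"
    by (simp add: etr_def)
  moreover have "coprime (p ^ 2) 2"
    using prime_imp_coprime[OF p(1) p23(1)] by simp
  ultimately have "p ^ 2 dvd re w"
    by (simp add: coprime_dvd_mult_right_iff)
  with iw have "of_int (p ^ 2) dvd w * ecnj B"
    by (intro dvd_mult2) (simp add: of_int_dvd_eis_iff del: of_int_power)
  moreover have "w * ecnj B = x ^ 3 * of_int (p * k)"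
    using mult_ecnj[of B] by (simp add: w_def B D mult.assoc)
  ultimately have "p ^ 2 dvd p * (k * re (x ^ 3))" "p ^ 2 dvd p * (k * im (x ^ 3))"
    by (simp_all add: of_int_dvd_eis_iff algebra_simps del: of_int_mult of_int_power)
  then have x3: "p dvd re (x ^ 3)" "p dvd im (x ^ 3)"
    using p0 p(1) D(2) by (simp_all add: power2_eq_square prime_dvd_mult_iff)
  \<comment> \<open>The characteristic equation x^2 = Tr(x) x - N(x), applied twice. As p divides
    N(x), it reduces x^3 to Tr(x)^2 x modulo p.\<close>
  have "x ^ 3 = of_int (etr x ^ 2 - enorm x) * x - of_int (etr x * enorm x)"
    by (simp add: eis_eq_iff etr_def enorm_def power2_eq_square power3_eq_cube algebra_simps)
  then have "p dvd (etr x ^ 2 - enorm x) * re x - etr x * enorm x"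
    "p dvd (etr x ^ 2 - enorm x) * im x"
    using x3 by (simp_all del: of_int_mult of_int_power of_int_diff)
  moreover have "(etr x ^ 2 - enorm x) * re x - etr x * enorm x = etr x ^ 2 * re x - enorm x * (re x + etr x)"
    "(etr x ^ 2 - enorm x) * im x = etr x ^ 2 * im x - enorm x * im x"
    by (simp_all add: algebra_simps)
  ultimately have T: "p dvd etr x ^ 2 * re x" "p dvd etr x ^ 2 * im x"
    using Nx by (metis dvd_diff_left_iff dvd_mult2)+
  show ?thesis
  proof (cases "p dvd etr x")
    case True
    have "3 * im x ^ 2 = 4 * enorm x - etr x ^ 2"
      by (simp add: enorm_def etr_def power2_eq_square algebra_simps)
    moreover have "p dvd 4 * enorm x - etr x ^ 2"
      using True Nx by (simp add: power2_eq_square)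
    ultimately have "p dvd 3 * im x ^ 2" by simp
    then have i: "p dvd im x"
      using p(1) p23 by (simp add: prime_dvd_mult_iff prime_dvd_power_iff)
    then have "p dvd etr x + im x" using True by simp
    then have "p dvd re x"
      using p(1) p23 by (simp add: etr_def prime_dvd_mult_iff)
    with i show ?thesis by (simp add: of_int_dvd_eis_iff)
  next
    case False
    then show ?thesis
      using T p(1) by (simp add: of_int_dvd_eis_iff prime_dvd_mult_iff prime_dvd_power_iff)
  qed
qed

text \<open>The norm condition yields only divisibility by the ramified prime 1 - \<zeta>. The
  missing factor comes from the trace condition, which modulo 27 sees just
  \<open>im B\<close>.\<close>

lemma eis_dvd_if_three:
  assumes D: "\<not> 3 dvd D" and B: "\<not> 3 dvd im B"
    and N: "9 dvd 3 * D * enorm x" and Tr: "27 dvd D * etr (x ^ 3 * B)"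
  shows "3 dvd x"
proof -
  have p3: "prime (3 :: int)" by simp
  have "3 * 3 dvd 3 * (D * enorm x)" using N by (simp add: mult.assoc)
  then have "3 dvd D * enorm x" by (subst (asm) dvd_mult_cancel_left) simp
  then have "3 dvd enorm x"
    using D p3 by (simp add: prime_dvd_mult_iff)
  moreover have "(re x + im x) ^ 2 = enorm x + 3 * (re x * im x)"
    by (simp add: enorm_def power2_eq_square algebra_simps)
  ultimately have "3 dvd (re x + im x) ^ 2" by simp
  then have "3 dvd re x + im x"
    using p3 by (simp add: prime_dvd_power_iff)
  then obtain j where "re x + im x = 3 * j" by (elim dvdE)
  then have j: "im x = 3 * j - re x" by simp
  have "coprime 27 D"
    using prime_imp_coprime[OF p3 D] coprime_power_left_iff[of 3 3 D] by simp
  then have "27 dvd etr (x ^ 3 * B)"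
    using Tr by (simp add: coprime_dvd_mult_right_iff)
  \<comment> \<open>With r = \<open>re x\<close>, x = r (1 - \<zeta>) + 3 j \<zeta>. The witness is
    the trace of B times (x^3 - r^3 (1 - \<zeta>)^3) / 27, and (1 - \<zeta>)^3 B has trace 9
    \<open>im B\<close>.\<close>
  moreover have "\<exists>k. etr (x ^ 3 * B) = 9 * re x ^ 3 * im B + 27 * k"
    by (rule exI[of _ "etr (Eis (j ^ 3 - 2 * re x * j ^ 2 + re x ^ 2 * j) (re x ^ 2 * j - re x * j ^ 2) * B)"])
      (simp add: etr_def j power3_eq_cube power2_eq_square algebra_simps)
  ultimately have "27 dvd 9 * (re x ^ 3 * im B)"
    by (metis dvd_add_left_iff dvd_triv_left mult.assoc)
  then have "3 dvd re x ^ 3 * im B" by presburger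
  then have "3 dvd re x"
    using p3 B by (simp add: prime_dvd_mult_iff prime_dvd_power_iff)
  then have "of_int 3 dvd x"
    unfolding of_int_dvd_eis_iff j by simp
  then show ?thesis by simp
qed

lemma eis_dvd_if_integrality_conditions:
  assumes p: "prime (p :: int)" and D: "squarefree D" "coprime D 6"
    and B: "enorm B = D" "\<not> 3 dvd im B"
    and N: "\<And>y. y \<in> {0, 1, Eis 0 1} \<Longrightarrow> p ^ 2 dvd 3 * D * enorm (x + of_int p * y)"
    and Tr: "p ^ 3 dvd D * etr (x ^ 3 * B)"
  shows "of_int p dvd x"
proof -
  have not_both: False if "p dvd D" "p dvd 6"
    using that D(2) p by (meson coprime_common_divisor not_prime_unit)
  have N0: "p ^ 2 dvd 3 * D * enorm x"
    using N[of 0] by simp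
  consider "p dvd 3" | "p dvd D" | "\<not> p dvd 3" "\<not> p dvd D" by blast
  then show ?thesis
  proof cases
    case 1
    then have "p = 3"
      using p primes_dvd_imp_eq[of p 3] by simp
    moreover have "\<not> 3 dvd D"
      using not_both \<open>p = 3\<close> by auto
    ultimately show ?thesis
      using eis_dvd_if_three[OF _ B(2)] N0 Tr by simp
  next
    case 2
    then obtain k where k: "D = p * k" by (elim dvdE)
    have "\<not> p dvd k"
    proof
      assume "p dvd k"
      then have "p ^ 2 dvd D"
        by (auto simp: k power2_eq_square)
      then have "is_unit p"
        using D(1) by (simp add: squarefree_def)
      then show False
        using p by auto
    qed
    then show ?thesis
      using eis_dvd_if_prime_dvd[OF p _ k _ B(1) N0 Tr] not_both[OF 2] by blast
  next
    case 3
    then show ?thesis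
      using eis_dvd_if_prime_not_dvd[OF p _ _ N] by blast
  qed
qed

subsection \<open>The square-free discriminant data\<close>

text \<open>A factor of norm prime to 3 is invertible modulo 3, with its conjugate as inverse up to
  an integer.\<close>

lemma eis_three_dvd_if_mult:
  assumes "a * b = 3 * (z :: eis)" and "\<not> 3 dvd enorm a"
  obtains b' where "b = 3 * b'" "a * b' = z"
proof -
  have "of_int (enorm a) * b = ecnj a * (a * b)"
    by (simp add: mult_ecnj[symmetric] mult_ac)
  also have "\<dots> = of_int 3 * (ecnj a * z)"
    by (simp add: assms(1) mult_ac)
  finally have dvd: "of_int 3 dvd of_int (enorm a) * b"
    by (metis dvd_triv_left)
  have "coprime 3 (enorm a)"
    using assms(2) by (simp add: prime_imp_coprime)
  then have "of_int 3 dvd b"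
    using dvd by (rule of_int_dvd_of_int_mult_eis_cancel)
  then obtain b' where b': "b = of_int 3 * b'" by (elim dvdE)
  then have "of_int 3 * (a * b') = of_int 3 * z"
    using assms(1) by (simp add: mult_ac)
  then have "a * b' = z"
    by (subst (asm) of_int_mult_eis_cancel) simp
  with b' that show ?thesis by simp
qed

lemma three_dvd_enorm_iff: "3 dvd enorm a \<longleftrightarrow> 3 dvd re a + im a"
proof -
  have "(re a + im a) ^ 2 = enorm a + 3 * (re a * im a)"
    by (simp add: enorm_def power2_eq_square algebra_simps)
  then have "3 dvd enorm a \<longleftrightarrow> 3 dvd (re a + im a) ^ 2"
    by (metis dvd_add_left_iff dvd_triv_left)
  then show ?thesis
    by (simp add: prime_dvd_power_iff)
qed

text \<open>1 - \<zeta> is the prime above 3; the quotient comes from 3 \<zeta> = -(1 -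
  \<zeta>)^2.\<close>

lemma eis_dvd_lambda:
  assumes "3 dvd enorm a"
  obtains a' where "a = Eis 1 (-1) * a'"
proof -
  obtain j where "re a + im a = 3 * j"
    using assms unfolding three_dvd_enorm_iff by (elim dvdE)
  then have "a = Eis 1 (-1) * Eis (re a - j) j"
    by (simp add: eis_eq_iff)
  then show ?thesis using that by blast
qed

text \<open>Cubes are integers modulo \<open>3\<close>, which reduces \<open>B\<close> modulo \<open>3\<close> to a multiple of the
  conjugate of \<open>z\<close>.\<close>

lemma three_not_dvd_im:
  assumes ab: "a * b = z" and split: "a ^ 2 * ecnj b = of_int k * B"
    and Na: "\<not> 3 dvd enorm a" and im: "\<not> 3 dvd im (y * ecnj z)"
  shows "\<not> 3 dvd im (y * B)"
proof
  assume "3 dvd im (y * B)"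
  then have l: "3 dvd im (of_int (enorm a * k) * (y * B))" by simp
  \<comment> \<open>The factor N(a) = a bar(a) completes a^2 bar(b) to a^3 bar(z), so that the cube
    can be reduced modulo 3. The lemma is applied with the units y = 1 and y = -\<zeta>.\<close>
  have "of_int (enorm a * k) * (y * B) = y * ((a * ecnj a) * (a ^ 2 * ecnj b))"
    unfolding split mult_ecnj by (simp add: mult_ac)
  also have "\<dots> = a ^ 3 * (y * ecnj z)"
    by (simp add: ab[symmetric] ecnj_hom power2_eq_square power3_eq_cube mult_ac)
  finally have eq: "of_int (enorm a * k) * (y * B) = a ^ 3 * (y * ecnj z)" .
  obtain w where w: "a ^ 3 = of_int (re a + im a) + 3 * w"
    by (rule eis_cube_mod_3)
  have "im (a ^ 3 * (y * ecnj z)) = (re a + im a) * im (y * ecnj z) + 3 * im (w * (y * ecnj z))"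
    unfolding w by (simp add: algebra_simps)
  with l eq have "3 dvd (re a + im a) * im (y * ecnj z) + 3 * im (w * (y * ecnj z))"
    by metis
  then have "3 dvd (re a + im a) * im (y * ecnj z)"
    by (subst (asm) dvd_add_left_iff) simp_all
  then show False
    using Na im by (simp add: three_dvd_enorm_iff prime_dvd_mult_iff del: eis_sel)
qed

lemma nine_not_dvd_squarefree: "squarefree (d :: int) \<Longrightarrow> \<not> 9 dvd d"
  using squarefreeD[of d 3] by auto

text \<open>Here n = 3 m and n^2 + 3 n + 9 is 9 times a number q prime to 6. The factor 9 sits in
  e^2, so e = 3 e', A = 3 z with N(z) = q, and D = d e'. Trace and norm of z are coprime because 4 q
  - (2 m + 1)^2 = 3.\<close>

lemma simplest_cubic_data_three_not_dvd_c:
  fixes m d e c :: int and a b :: eis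
  assumes m: "\<not> [m = 1] (mod 3)" and pos: "d > 0" "e > 0" "c > 0"
    and fact: "9 * (m ^ 2 + m + 1) = d * e ^ 2 * c ^ 3"
    and sqf: "squarefree d" "squarefree e" "coprime d e"
    and Na: "e * c = 3 * enorm a" and ab: "a * b = Eis (3 * m + 3) 3"
  obtains D B where "D > 0" "squarefree D" "coprime D 6" "enorm B = D" "\<not> 3 dvd im B"
    "9 * (m ^ 2 + m + 1) * enorm a = (e * c ^ 2) ^ 2 * D"
    "of_int (9 * (m ^ 2 + m + 1)) * a ^ 3 * Eis (3 * m) (-3) = of_int ((e * c ^ 2) ^ 3 * D) * B"
proof -
  define q where "q = m ^ 2 + m + 1"
  have "\<exists>k. m = 3 * k \<or> m = 3 * k + 2"
    using m by (simp add: cong_def) presburger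
  then obtain k where k: "m = 3 * k \<or> m = 3 * k + 2" ..
  have "q = 3 * (3 * k ^ 2 + k) + 1 \<or> q = 3 * (3 * k ^ 2 + 5 * k + 2) + 1"
    using k by (auto simp: q_def power2_eq_square algebra_simps)
  then have q3: "\<not> 3 dvd q" by presburger
  have "even (m * (m + 1))" by simp
  then have q2: "odd q"
    by (simp add: q_def power2_eq_square algebra_simps)
  have c3: "\<not> 3 dvd c"
  proof
    assume "3 dvd c"
    then obtain x where "c = 3 * x" by (elim dvdE)
    then have "q = 3 * (d * e ^ 2 * x ^ 3)"
      using fact by (simp add: q_def power_mult_distrib)
    with q3 show False by simp
  qed
  have "3 dvd e * c"
    using Na by simp
  then have "3 dvd e"
    using c3 by (simp add: prime_dvd_mult_iff)
  then obtain e' where e': "e = 3 * e'" by (elim dvdE)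
  have e'0: "e' > 0" using pos e' by simp
  have fact': "q = d * e' ^ 2 * c ^ 3"
    using fact by (simp add: e' q_def power_mult_distrib)
  have Na': "enorm a = e' * c"
    using Na by (simp add: e')
  define z where "z = Eis (m + 1) 1"
  have Nz: "enorm z = q" and Tz: "etr z = 2 * m + 1"
    by (simp_all add: z_def q_def enorm_def etr_def power2_eq_square algebra_simps)
  have "enorm a dvd q"
    by (simp add: Na' fact' power2_eq_square power3_eq_cube)
  then have Na3: "\<not> 3 dvd enorm a"
    using q3 dvd_trans by blast
  have "a * b = 3 * z"
    by (simp add: ab z_def eis_eq_iff)
  then obtain b' where b': "b = 3 * b'" "a * b' = z"
    using Na3 by (rule eis_three_dvd_if_mult)
  have "e' * c * enorm b' = q"
    using Nz b'(2) enorm_mult[of a b'] Na' by simp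
  then have "e' * c * enorm b' = e' * c * (d * e' * c ^ 2)"
    unfolding fact' by (simp add: power2_eq_square power3_eq_cube mult_ac)
  moreover have "e' * c \<noteq> 0"
    using pos e'0 by simp
  ultimately have Nb': "enorm b' = d * e' * c ^ 2"
    using mult_left_cancel by blast
  have "coprime (etr (a * b')) (e' * c)"
  proof (rule coprimeI)
    fix g assume g: "g dvd etr (a * b')" "g dvd e' * c"
    then have "g dvd q" "g dvd 2 * m + 1"
      using \<open>enorm a dvd q\<close> by (auto simp: Na' b' Tz intro: dvd_trans)
    then have "g dvd 4 * q - (2 * m + 1) * (2 * m + 1)" by simp
    then have "g dvd 3" by (simp add: q_def power2_eq_square algebra_simps)
    moreover have "coprime 3 q"
      using q3 by (simp add: prime_imp_coprime)
    ultimately show "is_unit g"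
      using \<open>g dvd q\<close> by (meson coprime_common_divisor)
  qed
  with Na' Nb' obtain B where B: "a ^ 2 * ecnj b' = of_int (e' * c ^ 2) * B" "enorm B = d * e'"
    using e'0 pos(3) by (rule eis_cube_split)
  have "d * e' dvd q"
    by (simp add: fact' power2_eq_square)
  moreover have "coprime 6 q"
  proof -
    have "coprime 2 q" "coprime 3 q"
      using q2 prime_imp_coprime[OF _ q3] by simp_all
    then have "coprime (2 * 3) q"
      by (simp only: coprime_mult_left_iff)
    then show ?thesis by simp
  qed
  ultimately have D6: "coprime (d * e') 6"
    by (meson coprime_commute coprime_divisors dvd_refl)
  have "squarefree e'" "coprime d e'"
    using sqf squarefree_mono[of e' e] by (simp_all add: e')
  then have D: "squarefree (d * e')"
    using sqf(1) by (intro squarefree_mult_coprime) auto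
  \<comment> \<open>The conjugate of z is m - \<zeta>, whose second coordinate is -1.\<close>
  have "\<not> 3 dvd im (1 * B)"
    using b'(2) B(1) Na3 by (rule three_not_dvd_im) (simp add: z_def)
  then have imB: "\<not> 3 dvd im B" by simp
  have "9 * q * enorm a = (e * c ^ 2) ^ 2 * (d * e')"
    by (simp add: Na' fact' e' power2_eq_square power3_eq_cube)
  moreover have "of_int (9 * q) * a ^ 3 * Eis (3 * m) (-3) = of_int ((e * c ^ 2) ^ 3 * (d * e')) * B"
  proof -
    have "Eis (3 * m) (-3) = 3 * (ecnj a * ecnj b')"
      by (simp add: ecnj_hom(2)[symmetric] b' z_def eis_eq_iff)
    then have "of_int (9 * q) * a ^ 3 * Eis (3 * m) (-3)
        = of_int (27 * q) * ((a * ecnj a) * (a ^ 2 * ecnj b'))"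
      by (simp add: power2_eq_square power3_eq_cube mult_ac)
    also have "\<dots> = of_int ((e * c ^ 2) ^ 3 * (d * e')) * B"
      unfolding mult_ecnj Na' B(1) fact' e'
      by (simp add: power2_eq_square power3_eq_cube mult_ac)
    finally show ?thesis .
  qed
  ultimately show ?thesis
    using that[of "d * e'" B] pos e'0 D D6 B(2) imB unfolding q_def by simp
qed

text \<open>Here n = 9 k + 3 and n^2 + 3 n + 9 is 27 times a number q prime to 6. The factor 27 sits
  in c^3, and D = d e. Both a and A are divisible by 1 - \<zeta>, which has to be removed before
  \<open>eis_cube_split\<close> applies.\<close>

lemma simplest_cubic_data_three_dvd_c:
  fixes k d e c :: int and a b :: eis
  assumes k: "\<not> [k = 1] (mod 3)" and pos: "d > 0" "e > 0" "c > 0"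
    and fact: "27 * (3 * k ^ 2 + 3 * k + 1) = d * e ^ 2 * c ^ 3"
    and sqf: "squarefree d" "squarefree e" "coprime d e"
    and Na: "e * c = enorm a" and ab: "a * b = Eis (9 * k + 6) 3"
  obtains D B where "D > 0" "squarefree D" "coprime D 6" "enorm B = D" "\<not> 3 dvd im B"
    "27 * (3 * k ^ 2 + 3 * k + 1) * enorm a = (e * c ^ 2) ^ 2 * D"
    "of_int (27 * (3 * k ^ 2 + 3 * k + 1)) * a ^ 3 * Eis (9 * k + 3) (-3)
      = of_int ((e * c ^ 2) ^ 3 * D) * B"
proof -
  define q where "q = 3 * k ^ 2 + 3 * k + 1"
  have q3: "\<not> 3 dvd q" unfolding q_def by presburger
  have "even (k * (k + 1))" by simp
  then have q2: "odd q"
    by (simp add: q_def power2_eq_square algebra_simps)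
  \<comment> \<open>Since d and e are square-free and coprime, d e^2 contains 3 at most
    twice.\<close>
  have "3 dvd c"
  proof (rule ccontr)
    assume "\<not> 3 dvd c"
    then have "coprime (27 :: int) (c ^ 3)"
      using prime_imp_coprime[of 3 c] coprime_power_left_iff[of 3 3 c] by simp
    then have de: "27 dvd d * e ^ 2"
      using fact by (metis coprime_dvd_mult_left_iff dvd_triv_left)
    show False
    proof (cases "3 dvd d")
      case True
      then have "\<not> 3 dvd e"
        using sqf(3) by (auto dest: coprime_common_divisor)
      then have "coprime (27 :: int) (e ^ 2)"
        using prime_imp_coprime[of 3 e] coprime_power_left_iff[of 3 3 e] by simp
      then have "27 dvd d"
        using de by (simp add: coprime_dvd_mult_left_iff)
      then have "9 dvd d"
        by (rule dvd_trans[rotated]) simp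
      then show False
        using nine_not_dvd_squarefree sqf(1) by blast
    next
      case False
      then have "coprime (27 :: int) d"
        using prime_imp_coprime[of 3 d] coprime_power_left_iff[of 3 3 d] by simp
      then have e27: "27 dvd e ^ 2"
        using de by (simp add: coprime_dvd_mult_right_iff)
      then have "3 dvd e ^ 2" by presburger
      then have "3 dvd e" by (simp add: prime_dvd_power_iff)
      then obtain x where x: "e = 3 * x" by (elim dvdE)
      then have "27 dvd 9 * x ^ 2"
        using e27 by (simp add: power_mult_distrib)
      then have "3 dvd x ^ 2" by presburger
      then have "3 dvd x" by (simp add: prime_dvd_power_iff)
      then have "9 dvd e" using x by presburger
      then show False
        using nine_not_dvd_squarefree sqf(2) by blast
    qed
  qed
  then obtain c' where c': "c = 3 * c'" by (elim dvdE)
  have c'0: "c' > 0" using pos c' by simp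
  have fact': "q = d * e ^ 2 * c' ^ 3"
    using fact by (simp add: c' q_def power_mult_distrib)
  define l where "l = Eis 1 (-1)"
  have "3 dvd enorm a"
    using Na[symmetric] by (simp add: c')
  then obtain a' where a': "a = l * a'"
    unfolding l_def by (rule eis_dvd_lambda)
  have Nl: "enorm l = 3"
    by (simp add: l_def enorm_def)
  have Na': "enorm a' = e * c'"
    using Na by (simp add: a' c' enorm_mult Nl)
  \<comment> \<open>z is A divided by 3 (1 - \<zeta>).\<close>
  define z where "z = Eis (2 * k + 1) (k + 1)"
  have Nz: "enorm z = q" and Tz: "etr z = 3 * k + 1"
    by (simp_all add: z_def q_def enorm_def etr_def power2_eq_square algebra_simps)
  have "enorm a' dvd q"
    by (simp add: Na' fact' power2_eq_square power3_eq_cube)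
  then have Na3: "\<not> 3 dvd enorm a'"
    using q3 dvd_trans by blast
  have lz: "Eis (9 * k + 6) 3 = l * (3 * z)"
    by (simp add: z_def l_def eis_eq_iff)
  have "ecnj l * (l * (a' * b)) = ecnj l * (l * (3 * z))"
    using ab unfolding lz a' by (simp add: mult.assoc)
  moreover have "ecnj l * (l * x) = of_int 3 * x" for x
    using mult_ecnj[of l] Nl by (metis mult.assoc mult.commute)
  ultimately have "of_int 3 * (a' * b) = of_int 3 * (3 * z)"
    by simp
  then have "a' * b = 3 * z"
    by (subst (asm) of_int_mult_eis_cancel) simp
  then obtain b' where b': "b = 3 * b'" "a' * b' = z"
    using Na3 by (rule eis_three_dvd_if_mult)
  have "e * c' * enorm b' = q"
    using Nz b'(2) enorm_mult[of a' b'] Na' by simp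
  then have "e * c' * enorm b' = e * c' * (d * e * c' ^ 2)"
    unfolding fact' by (simp add: power2_eq_square power3_eq_cube mult_ac)
  moreover have "e * c' \<noteq> 0"
    using pos c'0 by simp
  ultimately have Nb': "enorm b' = d * e * c' ^ 2"
    using mult_left_cancel by blast
  have "coprime (etr (a' * b')) (e * c')"
  proof (rule coprimeI)
    fix g assume g: "g dvd etr (a' * b')" "g dvd e * c'"
    then have "g dvd q" and T: "g dvd 3 * k + 1"
      using \<open>enorm a' dvd q\<close> by (auto simp: Na' b' Tz intro: dvd_trans)
    then have "g dvd 3 * q - (3 * k + 1) * (3 * k + 1) - (3 * k + 1)"
      by simp
    also have "3 * q - (3 * k + 1) * (3 * k + 1) - (3 * k + 1) = 1"
      by (simp add: q_def power2_eq_square algebra_simps)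
    finally show "is_unit g" .
  qed
  with Na' Nb' obtain B where B: "a' ^ 2 * ecnj b' = of_int (e * c' ^ 2) * B" "enorm B = d * e"
    using pos(2) c'0 by (rule eis_cube_split)
  \<comment> \<open>The unit -\<zeta> is what remains of (1 - \<zeta>)^2 = -3 \<zeta> when the
    powers of 3 are collected.\<close>
  define B' where "B' = Eis 0 (-1) * B"
  have "d * e dvd q"
    by (simp add: fact' power2_eq_square)
  moreover have "coprime 6 q"
  proof -
    have "coprime 2 q" "coprime 3 q"
      using q2 prime_imp_coprime[OF _ q3] by simp_all
    then have "coprime (2 * 3) q"
      by (simp only: coprime_mult_left_iff)
    then show ?thesis by simp
  qed
  ultimately have D6: "coprime (d * e) 6"
    by (meson coprime_commute coprime_divisors dvd_refl)
  have D: "squarefree (d * e)"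
    using sqf by (intro squarefree_mult_coprime) auto
  \<comment> \<open>-\<zeta> times the conjugate of z has second coordinate -(2 k + 1), which 3
    divides exactly if k = 1 modulo 3, that is, n = 12 modulo 27.\<close>
  have "\<not> 3 dvd 2 * k + 1"
    using k by (simp add: cong_def) presburger
  then have "\<not> 3 dvd im (Eis 0 (-1) * ecnj z)"
    by (simp add: z_def) presburger
  with b'(2) B(1) Na3 have imB: "\<not> 3 dvd im B'"
    unfolding B'_def by (rule three_not_dvd_im)
  have "27 * q * enorm a = (e * c ^ 2) ^ 2 * (d * e)"
    by (simp add: Na[symmetric] fact' c' power2_eq_square power3_eq_cube)
  moreover have "of_int (27 * q) * a ^ 3 * Eis (9 * k + 3) (-3) = of_int ((e * c ^ 2) ^ 3 * (d * e)) * B'"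
  proof -
    have l2: "l ^ 2 = 3 * Eis 0 (-1)"
      by (simp add: l_def eis_eq_iff power2_eq_square)
    have "Eis (9 * k + 3) (-3) = ecnj (Eis (9 * k + 6) 3)"
      by (simp add: eis_eq_iff)
    also have "\<dots> = 3 * (ecnj l * (ecnj a' * ecnj b'))"
      unfolding lz b'(2)[symmetric] by (simp add: ecnj_hom mult_ac)
    finally have "of_int (27 * q) * a ^ 3 * Eis (9 * k + 3) (-3)
        = of_int (81 * q) * (l ^ 2 * (l * ecnj l) * (a' * ecnj a') * (a' ^ 2 * ecnj b'))"
      by (simp add: a' power2_eq_square power3_eq_cube mult_ac)
    also have "\<dots> = of_int ((e * c ^ 2) ^ 3 * (d * e)) * B'"
      unfolding l2 mult_ecnj Nl Na' B(1) fact' c' B'_def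
      by (simp add: power2_eq_square power3_eq_cube mult_ac)
    finally show ?thesis .
  qed
  moreover have "enorm B' = d * e"
    by (simp add: B'_def enorm_mult B(2)) (simp add: enorm_def)
  ultimately show ?thesis
    using that[of "d * e" B'] pos D D6 imB unfolding q_def by simp
qed

lemma simplest_cubic_data:
  fixes n d e c :: int and a b :: eis
  assumes n: "3 dvd n" "\<not> [n = 12] (mod 27)" and pos: "d > 0" "e > 0" "c > 0"
    and fact: "n ^ 2 + 3 * n + 9 = d * e ^ 2 * c ^ 3"
    and sqf: "squarefree d" "squarefree e" "coprime d e"
    and Na1: "[n = 3] (mod 9) \<Longrightarrow> e * c = enorm a"
    and Na2: "[n = 0] (mod 9) \<or> [n = 6] (mod 9) \<Longrightarrow> e * c = 3 * enorm a"
    and ab: "a * b = Eis (n + 3) 3"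
  obtains D B where "D > 0" "squarefree D" "coprime D 6" "enorm B = D" "\<not> 3 dvd im B"
    "(n ^ 2 + 3 * n + 9) * enorm a = (e * c ^ 2) ^ 2 * D"
    "of_int (n ^ 2 + 3 * n + 9) * a ^ 3 * Eis n (-3) = of_int ((e * c ^ 2) ^ 3 * D) * B"
proof -
  obtain m where m: "n = 3 * m"
    using n(1) by (elim dvdE)
  have eq: "n ^ 2 + 3 * n + 9 = 9 * (m ^ 2 + m + 1)"
    by (simp add: m power2_eq_square)
  show ?thesis
  proof (cases "[m = 1] (mod 3)")
    case False
    then have N: "e * c = 3 * enorm a"
      by (intro Na2) (simp add: m cong_def, presburger)
    have ab': "a * b = Eis (3 * m + 3) 3"
      using ab by (simp add: m)
    show ?thesis
      by (rule simplest_cubic_data_three_not_dvd_c[OF False pos fact[unfolded eq] sqf N ab'])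
        (rule that[unfolded eq, unfolded m]; assumption)
  next
    case True
    then have "\<exists>k. m = 3 * k + 1"
      by (simp add: cong_def) presburger
    then obtain k where k: "m = 3 * k + 1" ..
    have nk: "n = 9 * k + 3"
      by (simp add: m k)
    have eq': "n ^ 2 + 3 * n + 9 = 27 * (3 * k ^ 2 + 3 * k + 1)"
      by (simp add: nk power2_eq_square algebra_simps)
    have k1: "\<not> [k = 1] (mod 3)"
    proof
      assume "[k = 1] (mod 3)"
      then obtain j where "k - 1 = 3 * j"
        by (auto simp: cong_iff_dvd_diff)
      then have "n - 12 = 27 * j"
        by (simp add: nk)
      then show False
        using n(2) by (simp add: cong_iff_dvd_diff)
    qed
    have N: "e * c = enorm a"
      by (intro Na1) (simp add: nk cong_def)
    have ab': "a * b = Eis (9 * k + 6) 3"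
      using ab by (simp add: nk)
    show ?thesis
      by (rule simplest_cubic_data_three_dvd_c[OF k1 pos fact[unfolded eq'] sqf N ab'])
        (rule that[unfolded eq', unfolded nk]; assumption)
  qed
qed

subsection \<open>The cubic and its roots\<close>

locale shanks_cubic =
  fixes n :: int and \<rho> :: complex
  assumes root: "\<rho> ^ 3 - of_int n * \<rho> ^ 2 - of_int (n + 3) * \<rho> - 1 = 0"
begin

definition N :: complex where "N = of_int n"

lemma rootN: "\<rho> ^ 3 - N * \<rho> ^ 2 - (N + 3) * \<rho> - 1 = 0"
  using root by (simp add: N_def)

lemma N_Rats [simp]: "N \<in> \<rat>"
  by (simp add: N_def)

text \<open>The polynomial form of -1 / (1 + \<rho>): it makes the coordinates of
  \<open>\<rho>1\<close> over the powers of \<rho> visible.\<close>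

definition \<rho>1 :: complex where "\<rho>1 = \<rho> ^ 2 - (N + 1) * \<rho> - 2"
definition \<rho>2 :: complex where "\<rho>2 = N - \<rho> - \<rho>1"

lemma root_not_minus_one: "1 + \<rho> \<noteq> 0"
proof
  assume "1 + \<rho> = 0"
  then have "\<rho> = -1" by (simp add: add_eq_0_iff)
  then show False using rootN by simp
qed

lemma rho1_eq: "\<rho>1 = - 1 / (1 + \<rho>)"
proof -
  have "\<rho>1 * (1 + \<rho>) = - 1"
    using rootN by (simp add: \<rho>1_def power2_eq_square power3_eq_cube algebra_simps)
  then show ?thesis
    by (subst nonzero_eq_divide_eq) (use root_not_minus_one in auto)
qed

lemma rho_mult:
  "\<rho> * \<rho> = \<rho>1 + (N + 1) * \<rho> + 2"
  "\<rho> * \<rho>1 = - 1 - \<rho>1"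
  "\<rho>1 * \<rho>1 = N + 2 - \<rho> + N * \<rho>1"
proof -
  show 1: "\<rho> * \<rho> = \<rho>1 + (N + 1) * \<rho> + 2"
    by (simp add: \<rho>1_def power2_eq_square)
  show 2: "\<rho> * \<rho>1 = - 1 - \<rho>1"
    using rootN by (simp add: \<rho>1_def power2_eq_square power3_eq_cube algebra_simps)
  have "\<rho>1 * \<rho>1 = \<rho> * (\<rho> * \<rho>1) - (N + 1) * (\<rho> * \<rho>1) - 2 * \<rho>1"
    unfolding \<rho>1_def by (simp add: power2_eq_square algebra_simps)
  also have "\<rho> * (\<rho> * \<rho>1) = - \<rho> - \<rho> * \<rho>1"
    by (subst 2) (simp add: algebra_simps)
  also have "- \<rho> - \<rho> * \<rho>1 - (N + 1) * (\<rho> * \<rho>1) - 2 * \<rho>1 =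
      1 + \<rho>1 - \<rho> - (N + 1) * (\<rho> * \<rho>1) - 2 * \<rho>1"
    by (simp only: 2) (simp add: algebra_simps)
  also have "1 + \<rho>1 - \<rho> - (N + 1) * (\<rho> * \<rho>1) - 2 * \<rho>1 =
      1 + \<rho>1 - \<rho> - (N + 1) * (- 1 - \<rho>1) - 2 * \<rho>1"
    by (simp only: 2)
  also have "\<dots> = N + 2 - \<rho> + N * \<rho>1"
    by (simp add: algebra_simps)
  finally show "\<rho>1 * \<rho>1 = N + 2 - \<rho> + N * \<rho>1" .
qed

text \<open>The polynomial that takes \<rho> to \<open>\<rho>1\<close> takes \<open>\<rho>1\<close>
  to \<open>\<rho>2\<close>; this will determine \<sigma> on \<open>\<rho>1\<close>.\<close>

lemma rho1_root_step: "\<rho>1 ^ 2 - (N + 1) * \<rho>1 - 2 = \<rho>2"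
  using rho_mult(3) by (simp add: \<rho>2_def power2_eq_square algebra_simps)

lemma roots:
  assumes "x ^ 3 - N * x ^ 2 - (N + 3) * x - 1 = 0"
  shows "x \<in> {\<rho>, \<rho>1, \<rho>2}"
proof -
  have e1: "\<rho> + \<rho>1 + \<rho>2 = N"
    by (simp add: \<rho>2_def)
  have "\<rho> * \<rho>1 + \<rho>1 * \<rho>2 + \<rho>2 * \<rho> =
      N * (\<rho> + \<rho>1) - \<rho> * \<rho> - \<rho> * \<rho>1 - \<rho>1 * \<rho>1"
    by (simp add: \<rho>2_def algebra_simps)
  also have "\<dots> = - (N + 3)"
    unfolding rho_mult by (simp add: algebra_simps)
  finally have e2: "\<rho> * \<rho>1 + \<rho>1 * \<rho>2 + \<rho>2 * \<rho> = - (N + 3)" .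
  have "\<rho> * \<rho>1 * \<rho>2 = N * (\<rho> * \<rho>1) - (\<rho> * \<rho>1) * \<rho> - (\<rho> * \<rho>1) * \<rho>1"
    by (simp add: \<rho>2_def algebra_simps)
  also have "\<dots> = N * (- 1 - \<rho>1) - (- 1 - \<rho>1) * \<rho> - (- 1 - \<rho>1) * \<rho>1"
    by (simp only: rho_mult(2))
  also have "\<dots> = N * (- 1 - \<rho>1) + \<rho> + \<rho> * \<rho>1 + \<rho>1 + \<rho>1 * \<rho>1"
    by (simp add: algebra_simps)
  also have "\<dots> = 1"
    unfolding rho_mult by (simp add: algebra_simps)
  finally have e3: "\<rho> * \<rho>1 * \<rho>2 = 1" .
  have "(x - \<rho>) * (x - \<rho>1) * (x - \<rho>2) =
      x ^ 3 - (\<rho> + \<rho>1 + \<rho>2) * x ^ 2 + (\<rho> * \<rho>1 + \<rho>1 * \<rho>2 + \<rho>2 * \<rho>) * x - \<rho> * \<rho>1 * \<rho>2"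
    by (simp add: power2_eq_square power3_eq_cube algebra_simps)
  also have "\<dots> = 0"
    unfolding e1 e2 e3 using assms by (simp add: algebra_simps)
  finally show ?thesis by auto
qed

section \<open>Linear independence of 1, \<rho> and \<open>\<rho>1\<close> over the
  rationals\<close>

lemma no_rational_root:
  assumes "x \<in> \<rat>" and x: "x ^ 3 - N * x ^ 2 - (N + 3) * x - 1 = (0 :: complex)"
  shows False
proof -
  have "algebraic_int x"
  proof (rule algebraic_int.intros)
    show "lead_coeff [:- 1, - (N + 3), - N, 1:] = 1" by simp
    show "\<forall>i. coeff [:- 1, - (N + 3), - N, 1:] i \<in> \<int>"
      by (auto simp: coeff_pCons N_def split: nat.split)
    show "poly [:- 1, - (N + 3), - N, 1:] x = 0"
      using x by (simp add: power2_eq_square power3_eq_cube algebra_simps)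
  qed
  then obtain k where k: "x = of_int k"
    using assms(1) rational_algebraic_int_is_int by (auto elim: Ints_cases)
  have "of_int (k ^ 3 - n * k ^ 2 - (n + 3) * k - 1) = (0 :: complex)"
    using x by (simp add: k N_def)
  then have "k ^ 3 - n * k ^ 2 - (n + 3) * k - 1 = 0"
    by (simp only: of_int_eq_0_iff)
  then have eq: "k * (k ^ 2 - n * k - (n + 3)) = 1"
    by (simp add: power2_eq_square power3_eq_cube algebra_simps)
  then have "k dvd 1" by (metis dvd_triv_left)
  then have "k = 1 \<or> k = - 1" by auto
  then show False
  proof
    \<comment> \<open>The equation becomes -2 n - 2 = 1, impossible by parity.\<close>
    assume "k = 1"
    then show False using eq by simp presburger
  next
    assume "k = - 1"
    then show False using eq by simp
  qed
qed

lemma root_irrational: "\<rho> \<notin> \<rat>"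
  using no_rational_root rootN by blast

lemma rho1_not_affine:
  assumes "a \<in> \<rat>" "b \<in> \<rat>" and eq: "\<rho>1 = a + b * \<rho>"
  shows False
proof -
  have sq: "\<rho> * \<rho> = (b + N + 1) * \<rho> + (a + 2)"
    using rho_mult(1) eq by (simp add: algebra_simps)
  have "a * \<rho> + b * (\<rho> * \<rho>) = - 1 - a - b * \<rho>"
    using rho_mult(2) by (simp add: eq algebra_simps)
  then have lin: "(a + b * (b + N + 1) + b) * \<rho> = - (b * (a + 2) + 1 + a)"
    unfolding sq by (simp add: algebra_simps)
  have coeff: "a + b * (b + N + 1) + b = 0"
  proof (rule ccontr)
    assume nz: "a + b * (b + N + 1) + b \<noteq> 0"
    then have "\<rho> = - (b * (a + 2) + 1 + a) / (a + b * (b + N + 1) + b)"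
      using lin by (simp add: eq_divide_eq mult.commute)
    also have "\<dots> \<in> \<rat>"
      using assms(1,2) by (intro Rats_divide Rats_add Rats_mult Rats_minus_iff[THEN iffD2]) auto
    finally show False
      using root_irrational by simp
  qed
  then have a: "a = - (b * (b + N + 1) + b)"
    by (simp add: eq_neg_iff_add_eq_0 algebra_simps)
  have "b * (a + 2) + 1 + a = 0"
    using lin coeff by (metis mult_zero_left neg_equal_0_iff_equal)
  \<comment> \<open>\<rho> would be a root of X^2 - (b + N + 1) X - (a + 2). As the roots of the
    cubic add up to N, the remaining linear factor would have the root -1 - b.\<close>
  then have "(- 1 - b) ^ 3 - N * (- 1 - b) ^ 2 - (N + 3) * (- 1 - b) - 1 = 0"
    unfolding a by (simp add: power2_eq_square power3_eq_cube algebra_simps)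
  then show False
    using no_rational_root[of "- 1 - b"] assms(2) by simp
qed

lemma lin_indep:
  assumes r: "u \<in> \<rat>" "v \<in> \<rat>" "w \<in> \<rat>" and eq: "u + v * \<rho> + w * \<rho>1 = 0"
  shows "u = 0" "v = 0" "w = 0"
proof -
  show w: "w = 0"
  proof (rule ccontr)
    assume "w \<noteq> 0"
    then have "\<rho>1 = - u / w + (- v / w) * \<rho>"
      using eq by (simp add: field_simps add_eq_0_iff)
    then show False
      using rho1_not_affine[of "- u / w" "- v / w"] r by simp
  qed
  show v: "v = 0"
  proof (rule ccontr)
    assume "v \<noteq> 0"
    then have "\<rho> = - u / v"
      using eq w by (simp add: field_simps add_eq_0_iff)
    then show False
      using root_irrational r by simp
  qed
  show "u = 0"
    using eq v w by simp
qed

text \<open>\<open>\<theta>\<close> and its conjugates have trace zero; on combinations of them \<open>\<sigma>\<close> acts like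
  multiplication by \<open>\<zeta>\<close> on coordinates.\<close>

definition \<theta> :: complex where "\<theta> = 3 * \<rho> - N"
definition \<theta>1 :: complex where "\<theta>1 = 3 * \<rho>1 - N"

definition \<Delta> :: int where "\<Delta> = n ^ 2 + 3 * n + 9"

lemma of_int_Delta: "(of_int \<Delta> :: complex) = N ^ 2 + 3 * N + 9"
  by (simp add: \<Delta>_def N_def)

lemma theta_mult:
  "\<theta> * \<theta> = (N + 3) * \<theta> + 3 * \<theta>1 + 2 * of_int \<Delta>"
  "\<theta> * \<theta>1 = - N * \<theta> - (N + 3) * \<theta>1 - of_int \<Delta>"
  "\<theta>1 * \<theta>1 = - 3 * \<theta> + N * \<theta>1 + 2 * of_int \<Delta>"
proof -
  have sq:
    "\<theta> * \<theta> = 9 * (\<rho> * \<rho>) - 6 * N * \<rho> + N ^ 2"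
    "\<theta> * \<theta>1 = 9 * (\<rho> * \<rho>1) - 3 * N * (\<rho> + \<rho>1) + N ^ 2"
    "\<theta>1 * \<theta>1 = 9 * (\<rho>1 * \<rho>1) - 6 * N * \<rho>1 + N ^ 2"
    by (simp_all add: \<theta>_def \<theta>1_def power2_eq_square algebra_simps)
  show "\<theta> * \<theta> = (N + 3) * \<theta> + 3 * \<theta>1 + 2 * of_int \<Delta>"
    unfolding sq rho_mult unfolding \<theta>_def \<theta>1_def of_int_Delta
    by (simp add: power2_eq_square algebra_simps)
  show "\<theta> * \<theta>1 = - N * \<theta> - (N + 3) * \<theta>1 - of_int \<Delta>"
    unfolding sq rho_mult unfolding \<theta>_def \<theta>1_def of_int_Delta
    by (simp add: power2_eq_square algebra_simps)
  show "\<theta>1 * \<theta>1 = - 3 * \<theta> + N * \<theta>1 + 2 * of_int \<Delta>"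
    unfolding sq rho_mult unfolding \<theta>_def \<theta>1_def of_int_Delta
    by (simp add: power2_eq_square algebra_simps)
qed

definition tcomb :: "complex \<Rightarrow> complex \<Rightarrow> complex" where
  "tcomb x y = x * \<theta> + y * \<theta>1"

text \<open>The trace of \<open>(x + y \<zeta>)\<^sup>3\<close> times the conjugate of \<open>n + 3 (1 + \<zeta>)\<close>.\<close>

definition cubic_form :: "complex \<Rightarrow> complex \<Rightarrow> complex" where
  "cubic_form x y = (2 * N + 3) * (x ^ 3 + y ^ 3 - 3 * x * y ^ 2)
    + (3 - N) * (3 * x ^ 2 * y - 3 * x * y ^ 2)"

text \<open>The three coordinate pairs are those of u, \<zeta> u and \<zeta>^2 u for u = x + y
  \<zeta>. The symmetric functions are computed before any automorphism is available; the three
  factors turn out to be conjugates in \<open>sigma_apply\<close> and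
  \<open>tau_apply\<close>.\<close>

lemma tcomb_sum: "tcomb x y + tcomb (- y) (x - y) + tcomb (y - x) (- x) = 0"
  by (simp add: tcomb_def algebra_simps)

lemma tcomb_sym2:
  "tcomb x y * tcomb (- y) (x - y) + tcomb (- y) (x - y) * tcomb (y - x) (- x)
      + tcomb (y - x) (- x) * tcomb x y = - 3 * of_int \<Delta> * (x ^ 2 - x * y + y ^ 2)"
proof -
  have "tcomb x y * tcomb (- y) (x - y) + tcomb (- y) (x - y) * tcomb (y - x) (- x)
      + tcomb (y - x) (- x) * tcomb x y
      = - (x ^ 2 - x * y + y ^ 2) * (\<theta> * \<theta> + \<theta> * \<theta>1 + \<theta>1 * \<theta>1)"
    by (simp add: tcomb_def power2_eq_square algebra_simps)
  also have "\<theta> * \<theta> + \<theta> * \<theta>1 + \<theta>1 * \<theta>1 = 3 * of_int \<Delta>"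
    unfolding theta_mult by (simp add: algebra_simps)
  finally show ?thesis by (simp add: algebra_simps)
qed

lemma tcomb_sym3:
  "tcomb x y * tcomb (- y) (x - y) * tcomb (y - x) (- x) = of_int \<Delta> * cubic_form x y"
proof -
  define D where "D = (of_int \<Delta> :: complex)"
  have D: "D = N ^ 2 + 3 * N + 9"
    by (simp add: D_def of_int_Delta)
  note m = theta_mult[folded D_def]
  have "\<theta> * (\<theta> * \<theta>) = (N + 3) * (\<theta> * \<theta>) + 3 * (\<theta> * \<theta>1) + 2 * D * \<theta>"
    using arg_cong[OF m(1), of "\<lambda>z. \<theta> * z"] by (simp add: algebra_simps)
  also have "\<dots> = 3 * D * \<theta> + D * (2 * N + 3)"
    unfolding m unfolding D by (simp add: power2_eq_square algebra_simps)
  finally have c1: "\<theta> * (\<theta> * \<theta>) = 3 * D * \<theta> + D * (2 * N + 3)" .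
  have "\<theta> * (\<theta> * \<theta>1) = - N * (\<theta> * \<theta>) - (N + 3) * (\<theta> * \<theta>1) - D * \<theta>"
    using arg_cong[OF m(2), of "\<lambda>z. \<theta> * z"] by (simp add: algebra_simps)
  also have "\<dots> = D * \<theta>1 - D * \<theta> + D * (3 - N)"
    unfolding m unfolding D by (simp add: power2_eq_square algebra_simps)
  finally have c2: "\<theta> * (\<theta> * \<theta>1) = D * \<theta>1 - D * \<theta> + D * (3 - N)" .
  have "\<theta> * (\<theta>1 * \<theta>1) = - 3 * (\<theta> * \<theta>) + N * (\<theta> * \<theta>1) + 2 * D * \<theta>"
    using arg_cong[OF m(3), of "\<lambda>z. \<theta> * z"] by (simp add: algebra_simps)
  also have "\<dots> = D * \<theta> - D * \<theta>1 - D * (N + 6)"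
    unfolding m unfolding D by (simp add: power2_eq_square algebra_simps)
  finally have c3: "\<theta> * (\<theta>1 * \<theta>1) = D * \<theta> - D * \<theta>1 - D * (N + 6)" .
  have "\<theta>1 * (\<theta>1 * \<theta>1) = - 3 * (\<theta> * \<theta>1) + N * (\<theta>1 * \<theta>1) + 2 * D * \<theta>1"
    using arg_cong[OF m(3), of "\<lambda>z. \<theta>1 * z"] by (simp add: algebra_simps)
  also have "\<dots> = 3 * D * \<theta>1 + D * (2 * N + 3)"
    unfolding m unfolding D by (simp add: power2_eq_square algebra_simps)
  finally have c4: "\<theta>1 * (\<theta>1 * \<theta>1) = 3 * D * \<theta>1 + D * (2 * N + 3)" .
  \<comment> \<open>After substituting the four cubic monomials, the contributions of
    \<open>\<theta>\<close> and \<open>\<theta>1\<close> cancel and a rational expression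
    remains.\<close>
  have "tcomb x y * tcomb (- y) (x - y) * tcomb (y - x) (- x) =
      (x * y * (x - y)) * (\<theta> * (\<theta> * \<theta>)) + (- (x ^ 3) + 3 * x ^ 2 * y - y ^ 3) * (\<theta> * (\<theta> * \<theta>1))
      + (- (x ^ 3) + 3 * x * y ^ 2 - y ^ 3) * (\<theta> * (\<theta>1 * \<theta>1))
      + (- x * y * (x - y)) * (\<theta>1 * (\<theta>1 * \<theta>1))"
    by (simp add: tcomb_def power2_eq_square power3_eq_cube algebra_simps)
  also have "\<dots> = D * cubic_form x y"
    unfolding c1 c2 c3 c4
    by (simp add: cubic_form_def power2_eq_square power3_eq_cube algebra_simps)
  finally show ?thesis
    by (simp add: D_def)
qed

end

subsection \<open>The cyclic cubic field and its Galois group\<close>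

lemma carrier_complex_on [simp]: "carrier (complex_on S) = S"
  and mult_complex_on [simp]: "x \<otimes>\<^bsub>complex_on S\<^esub> y = x * y"
  and add_complex_on [simp]: "x \<oplus>\<^bsub>complex_on S\<^esub> y = x + y"
  and one_complex_on [simp]: "\<one>\<^bsub>complex_on S\<^esub> = 1"
  and zero_complex_on [simp]: "\<zero>\<^bsub>complex_on S\<^esub> = 0"
  by (simp_all add: complex_on_def ring_of_type_algebra_def)

lemma field_complex_on_UNIV: "field (complex_on UNIV)"
proof -
  have "complex_on UNIV = (ring_of_type_algebra :: complex ring)"
    by (simp add: complex_on_def ring_of_type_algebra_def)
  then show ?thesis
    using field_from_type_algebra by simp
qed

lemma a_inv_complex_on: "\<ominus>\<^bsub>complex_on UNIV\<^esub> x = - x"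
proof -
  interpret field "complex_on UNIV" by (rule field_complex_on_UNIV)
  show ?thesis by (rule minus_equality) simp_all
qed

lemma m_inv_complex_on:
  assumes "x \<noteq> 0"
  shows "inv\<^bsub>complex_on UNIV\<^esub> x = inverse x"
proof -
  interpret field "complex_on UNIV" by (rule field_complex_on_UNIV)
  show ?thesis by (rule comm_inv_char) (use assms in simp_all)
qed

lemma rat_adjoin_closed:
  shows "1 \<in> rat_adjoin \<rho>" "\<rho> \<in> rat_adjoin \<rho>"
    and "x \<in> rat_adjoin \<rho> \<Longrightarrow> - x \<in> rat_adjoin \<rho>"
    and "x \<in> rat_adjoin \<rho> \<Longrightarrow> x \<noteq> 0 \<Longrightarrow> inverse x \<in> rat_adjoin \<rho>"
    and "x \<in> rat_adjoin \<rho> \<Longrightarrow> y \<in> rat_adjoin \<rho> \<Longrightarrow> x + y \<in> rat_adjoin \<rho>"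
    and "x \<in> rat_adjoin \<rho> \<Longrightarrow> y \<in> rat_adjoin \<rho> \<Longrightarrow> x * y \<in> rat_adjoin \<rho>"
proof -
  note gf = generate_field.intros[where R = "complex_on UNIV" and H = "{\<rho>}", folded rat_adjoin_def]
  show "1 \<in> rat_adjoin \<rho>" using gf(1) by simp
  show "\<rho> \<in> rat_adjoin \<rho>" using gf(2) by simp
  show "x \<in> rat_adjoin \<rho> \<Longrightarrow> - x \<in> rat_adjoin \<rho>"
    using gf(3)[of x] by (simp add: a_inv_complex_on)
  show "x \<in> rat_adjoin \<rho> \<Longrightarrow> x \<noteq> 0 \<Longrightarrow> inverse x \<in> rat_adjoin \<rho>"
    using gf(4)[of x] by (simp add: m_inv_complex_on)
  show "x \<in> rat_adjoin \<rho> \<Longrightarrow> y \<in> rat_adjoin \<rho> \<Longrightarrow> x + y \<in> rat_adjoin \<rho>"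
    using gf(5)[of x y] by simp
  show "x \<in> rat_adjoin \<rho> \<Longrightarrow> y \<in> rat_adjoin \<rho> \<Longrightarrow> x * y \<in> rat_adjoin \<rho>"
    using gf(6)[of x y] by simp
qed

lemma rat_adjoin_subset:
  assumes "1 \<in> S" "\<rho> \<in> S"
    and "\<And>x. x \<in> S \<Longrightarrow> - x \<in> S" "\<And>x. x \<in> S \<Longrightarrow> x \<noteq> 0 \<Longrightarrow> inverse x \<in> S"
    and "\<And>x y. x \<in> S \<Longrightarrow> y \<in> S \<Longrightarrow> x + y \<in> S" "\<And>x y. x \<in> S \<Longrightarrow> y \<in> S \<Longrightarrow> x * y \<in> S"
  shows "rat_adjoin \<rho> \<subseteq> S"
proof
  fix x assume "x \<in> rat_adjoin \<rho>"
  then show "x \<in> S"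
    unfolding rat_adjoin_def
    by (induction rule: generate_field.induct)
      (use assms in \<open>simp_all add: a_inv_complex_on m_inv_complex_on\<close>)
qed

lemma Rats_subset_rat_adjoin: "\<rat> \<subseteq> rat_adjoin \<rho>"
proof -
  note cl = rat_adjoin_closed[where \<rho> = \<rho>]
  have zero: "0 \<in> rat_adjoin \<rho>"
    using cl(5)[OF cl(1) cl(3)[OF cl(1)]] by simp
  have nat: "of_nat k \<in> rat_adjoin \<rho>" for k
    by (induction k) (use zero cl in auto)
  have int: "of_int k \<in> rat_adjoin \<rho>" for k
    by (cases k rule: int_cases2) (use nat cl(3) in auto)
  show ?thesis
  proof
    fix x :: complex assume "x \<in> \<rat>"
    then obtain a b where "b > 0" "x = of_int a / of_int b"
      by (rule Rats_cases')
    then show "x \<in> rat_adjoin \<rho>"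
      using cl(6)[OF int[of a] cl(4)[OF int[of b]]] by (simp add: divide_inverse)
  qed
qed

context shanks_cubic
begin

section \<open>An explicit model of the field, with coordinates over 1, \<open>\<theta>\<close> and
  \<open>\<theta>1\<close>\<close>

definition K :: "complex set" where
  "K = {k + tcomb x y |k x y. k \<in> \<rat> \<and> x \<in> \<rat> \<and> y \<in> \<rat>}"

lemma KI: "k \<in> \<rat> \<Longrightarrow> x \<in> \<rat> \<Longrightarrow> y \<in> \<rat> \<Longrightarrow> k + tcomb x y \<in> K"
  by (auto simp: K_def)

lemma KE:
  assumes "z \<in> K"
  obtains k x y where "k \<in> \<rat>" "x \<in> \<rat>" "y \<in> \<rat>" "z = k + tcomb x y"
  using assms by (auto simp: K_def)

lemma tcomb_0 [simp]: "tcomb 0 0 = 0"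
  by (simp add: tcomb_def)

lemma tcomb_add: "tcomb x y + tcomb x' y' = tcomb (x + x') (y + y')"
  by (simp add: tcomb_def algebra_simps)

lemma tcomb_scale: "c * tcomb x y = tcomb (c * x) (c * y)"
  by (simp add: tcomb_def algebra_simps)

lemma Rats_subset_K: "\<rat> \<subseteq> K"
  using KI[of _ 0 0] by auto

lemma rho_eq_tcomb: "\<rho> = N / 3 + tcomb (1 / 3) 0"
  by (simp add: tcomb_def \<theta>_def field_simps)

lemma K_indep:
  assumes "k \<in> \<rat>" "x \<in> \<rat>" "y \<in> \<rat>" and "k + tcomb x y = 0"
  shows "k = 0" "x = 0" "y = 0"
proof -
  have "(k - N * (x + y)) + (3 * x) * \<rho> + (3 * y) * \<rho>1 = 0"
    using assms(4) by (simp add: tcomb_def \<theta>_def \<theta>1_def algebra_simps)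
  note li = lin_indep[OF _ _ _ this]
  have r: "k - N * (x + y) \<in> \<rat>" "3 * x \<in> \<rat>" "3 * y \<in> \<rat>"
    using assms by auto
  show "x = 0" "y = 0"
    using li[OF r] by auto
  then show "k = 0"
    using assms(4) by simp
qed

lemma K_add: "z \<in> K \<Longrightarrow> w \<in> K \<Longrightarrow> z + w \<in> K"
proof (elim KE)
  fix k x y k' x' y'
  assume r: "k \<in> \<rat>" "x \<in> \<rat>" "y \<in> \<rat>" "k' \<in> \<rat>" "x' \<in> \<rat>" "y' \<in> \<rat>"
    and "z = k + tcomb x y" "w = k' + tcomb x' y'"
  then have "z + w = (k + k') + tcomb (x + x') (y + y')"
    by (simp add: tcomb_def algebra_simps)
  then show "z + w \<in> K"
    using r by (simp add: KI)
qed

lemma K_mult: "z \<in> K \<Longrightarrow> w \<in> K \<Longrightarrow> z * w \<in> K"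
proof (elim KE)
  fix k x y k' x' y'
  assume r: "k \<in> \<rat>" "x \<in> \<rat>" "y \<in> \<rat>" "k' \<in> \<rat>" "x' \<in> \<rat>" "y' \<in> \<rat>"
    and zw: "z = k + tcomb x y" "w = k' + tcomb x' y'"
  define D :: complex where "D = of_int \<Delta>"
  have D: "D \<in> \<rat>" by (simp add: D_def)
  note m = theta_mult[folded D_def]
  have "z * w = k * k' + k * tcomb x' y' + k' * tcomb x y +
      (x * x') * (\<theta> * \<theta>) + (x * y' + y * x') * (\<theta> * \<theta>1) + (y * y') * (\<theta>1 * \<theta>1)"
    by (simp add: zw tcomb_def algebra_simps)
  also have "\<dots> = (k * k' + D * (2 * x * x' - (x * y' + y * x') + 2 * y * y')) +
      tcomb (k * x' + k' * x + (N + 3) * (x * x') - N * (x * y' + y * x') - 3 * (y * y'))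
        (k * y' + k' * y + 3 * (x * x') - (N + 3) * (x * y' + y * x') + N * (y * y'))"
    unfolding m by (simp add: tcomb_def algebra_simps)
  also have "\<dots> \<in> K"
    using r D by (intro KI Rats_add Rats_diff Rats_mult) auto
  finally show "z * w \<in> K" .
qed

lemma norm_eq:
  "(k + tcomb x y) * (k + tcomb (- y) (x - y)) * (k + tcomb (y - x) (- x)) =
    k ^ 3 - 3 * of_int \<Delta> * (x ^ 2 - x * y + y ^ 2) * k + of_int \<Delta> * cubic_form x y"
proof -
  have expand: "(k + a) * (k + b) * (k + c) =
      k ^ 3 + (a + b + c) * k ^ 2 + (a * b + b * c + c * a) * k + a * b * c" for a b c :: complex
    by (simp add: power2_eq_square power3_eq_cube algebra_simps)
  show ?thesis
    unfolding expand tcomb_sum tcomb_sym2 tcomb_sym3 by simp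
qed

lemma cubic_form_Rats: "x \<in> \<rat> \<Longrightarrow> y \<in> \<rat> \<Longrightarrow> cubic_form x y \<in> \<rat>"
  unfolding cubic_form_def by (intro Rats_add Rats_diff Rats_mult Rats_power) auto

text \<open>The inverse is the product of the other two conjugates divided by the norm, which
  \<open>norm_eq\<close> shows to be rational.\<close>

lemma K_inverse:
  assumes "z \<in> K" "z \<noteq> 0"
  shows "inverse z \<in> K"
proof -
  obtain k x y where r: "k \<in> \<rat>" "x \<in> \<rat>" "y \<in> \<rat>" and z: "z = k + tcomb x y"
    using assms(1) by (rule KE)
  define z1 where "z1 = k + tcomb (- y) (x - y)"
  define z2 where "z2 = k + tcomb (y - x) (- x)"
  define M where "M = z * z1 * z2"
  have "M = k ^ 3 - 3 * of_int \<Delta> * (x ^ 2 - x * y + y ^ 2) * k + of_int \<Delta> * cubic_form x y"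
    by (simp only: M_def z z1_def z2_def norm_eq)
  also have "\<dots> \<in> \<rat>"
    using r cubic_form_Rats by (intro Rats_add Rats_diff Rats_mult Rats_power) auto
  finally have MR: "M \<in> \<rat>" .
  have "z1 \<noteq> 0"
  proof
    assume "z1 = 0"
    then have "k = 0" "y = 0" "x - y = 0"
      using K_indep[of k "- y" "x - y"] r by (auto simp: z1_def)
    with assms(2) z show False by simp
  qed
  moreover have "z2 \<noteq> 0"
  proof
    assume "z2 = 0"
    then have "k = 0" "x = 0" "y - x = 0"
      using K_indep[of k "y - x" "- x"] r by (auto simp: z2_def)
    with assms(2) z show False by simp
  qed
  ultimately have "inverse z = inverse M * (z1 * z2)"
    using assms(2) by (simp add: M_def field_simps)
  also have "\<dots> \<in> K"
    unfolding z1_def z2_def using r MR Rats_subset_K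
    by (intro K_mult KI) auto
  finally show ?thesis .
qed

theorem rat_adjoin_eq: "rat_adjoin \<rho> = K"
proof
  show "rat_adjoin \<rho> \<subseteq> K"
  proof (rule rat_adjoin_subset)
    show "1 \<in> K" using Rats_subset_K by auto
    show "\<rho> \<in> K"
      by (subst rho_eq_tcomb, intro KI) auto
    have "- 1 \<in> K"
      by (rule subsetD[OF Rats_subset_K]) simp
    then show "- x \<in> K" if "x \<in> K" for x
      using K_mult[of "- 1" x] that by simp
  qed (use K_add K_mult K_inverse in auto)
next
  note cl = rat_adjoin_closed[where \<rho> = \<rho>]
  have R: "x \<in> rat_adjoin \<rho>" if "x \<in> \<rat>" for x
    using Rats_subset_rat_adjoin that by blast
  have "\<theta> = 3 * \<rho> + (- N)" and "\<theta>1 = 3 * (\<rho> * \<rho> + (- (N + 1)) * \<rho> + (- 2)) + (- N)"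
    by (simp_all only: \<theta>_def \<theta>1_def \<rho>1_def power2_eq_square diff_conv_add_uminus mult_minus_left)
  moreover have "3 * \<rho> + (- N) \<in> rat_adjoin \<rho>"
    "3 * (\<rho> * \<rho> + (- (N + 1)) * \<rho> + (- 2)) + (- N) \<in> rat_adjoin \<rho>"
    by (intro cl(2,5,6) R Rats_minus_iff[THEN iffD2] Rats_add; simp)+
  ultimately have th: "\<theta> \<in> rat_adjoin \<rho>" "\<theta>1 \<in> rat_adjoin \<rho>"
    by simp_all
  show "K \<subseteq> rat_adjoin \<rho>"
  proof
    fix z assume "z \<in> K"
    then obtain k x y where "k \<in> \<rat>" "x \<in> \<rat>" "y \<in> \<rat>" "z = k + (x * \<theta> + y * \<theta>1)"
      by (elim KE) (simp add: tcomb_def)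
    then show "z \<in> rat_adjoin \<rho>"
      by (simp only:) (intro cl(5,6) th R)
  qed
qed

end

section \<open>The three automorphisms\<close>

locale shanks_galois = shanks_cubic +
  fixes G :: "(complex \<Rightarrow> complex) monoid" and \<sigma> :: "complex \<Rightarrow> complex"
  assumes G: "G = galois_group \<rat> K" and sigma: "\<sigma> \<in> carrier G" "\<sigma> \<rho> = \<rho>1"
begin

lemma carrier_iff:
  "g \<in> carrier G \<longleftrightarrow> g \<in> Bij K \<and> g \<in> Ring.ring_hom (complex_on K) (complex_on K) \<and> (\<forall>x\<in>\<rat>. g x = x)"
  by (simp add: G galois_group_def)

lemma galois_hom:
  assumes "g \<in> carrier G"
  shows "x \<in> \<rat> \<Longrightarrow> g x = x"
    and "x \<in> K \<Longrightarrow> g x \<in> K"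
    and "x \<in> K \<Longrightarrow> y \<in> K \<Longrightarrow> g (x + y) = g x + g y"
    and "x \<in> K \<Longrightarrow> y \<in> K \<Longrightarrow> g (x * y) = g x * g y"
  using assms Ring.ring_hom_memE[of g "complex_on K" "complex_on K"]
  unfolding carrier_iff by auto

lemma K_mem: "\<rho> \<in> K" "x \<in> \<rat> \<Longrightarrow> x \<in> K" "z \<in> K \<Longrightarrow> z ^ i \<in> K"
proof -
  show "\<rho> \<in> K" using rat_adjoin_closed(2) rat_adjoin_eq by blast
  show R: "x \<in> \<rat> \<Longrightarrow> x \<in> K" for x using Rats_subset_K by blast
  show "z \<in> K \<Longrightarrow> z ^ i \<in> K" by (induction i) (auto intro: R K_mult)
qed

lemma galois_power: "g \<in> carrier G \<Longrightarrow> z \<in> K \<Longrightarrow> g (z ^ i) = g z ^ i"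
  by (induction i) (simp_all add: galois_hom K_mem)

text \<open>Membership in \<open>K\<close> is carried along because g respects sums and products
  only there.\<close>

lemma galois_int_poly:
  assumes "g \<in> carrier G" "z \<in> K"
  shows "g (poly (map_poly of_int p) z) = poly (map_poly of_int p) (g z)
    \<and> poly (map_poly of_int p) z \<in> K"
proof (induction p)
  case (pCons a p)
  then show ?case
    using assms by (simp add: map_poly_pCons galois_hom K_mem K_add K_mult)
qed (simp add: galois_hom[OF assms(1)] K_mem)

lemma galois_algebraic_int:
  assumes "g \<in> carrier G" "z \<in> K" "algebraic_int z"
  shows "algebraic_int (g z)"
proof -
  obtain p where p: "poly (map_poly of_int p) z = 0" "lead_coeff p = (1 :: int)"
    using assms(3) by (auto simp: algebraic_int_altdef_ipoly)
  have "poly (map_poly of_int p) (g z) = 0"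
    using galois_int_poly[OF assms(1,2), of p] p(1) galois_hom(1)[OF assms(1), of 0] by simp
  with p(2) show ?thesis
    by (auto simp: algebraic_int_altdef_ipoly)
qed

lemma galois_tcomb:
  assumes g: "g \<in> carrier G" and r: "k \<in> \<rat>" "x \<in> \<rat>" "y \<in> \<rat>"
  shows "g (k + tcomb x y) =
    k + x * (3 * g \<rho> - N) + y * (3 * ((g \<rho>) ^ 2 - (N + 1) * g \<rho> - 2) - N)"
proof -
  define c where "c = k - N * (x + y) - 6 * y"
  define b where "b = 3 * x - 3 * y * (N + 1)"
  have bc: "b \<in> \<rat>" "c \<in> \<rat>" "3 * y \<in> \<rat>"
    using r by (auto simp: b_def c_def)
  have "k + tcomb x y = c + b * \<rho> + (3 * y) * \<rho> ^ 2"
    by (simp add: b_def c_def tcomb_def \<theta>_def \<theta>1_def \<rho>1_def algebra_simps)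
  also have "g \<dots> = c + b * g \<rho> + (3 * y) * (g \<rho>) ^ 2"
    using g bc by (simp add: galois_hom galois_power K_mem K_add K_mult)
  finally show ?thesis
    by (simp add: b_def c_def algebra_simps)
qed

lemma galois_eqI:
  assumes "g \<in> carrier G" "h \<in> carrier G" "g \<rho> = h \<rho>"
  shows "g = h"
proof (rule extensionalityI)
  show "g \<in> extensional K" "h \<in> extensional K"
    using assms(1,2) by (auto simp: carrier_iff Bij_def)
  show "g z = h z" if "z \<in> K" for z
    using that assms(3) by (elim KE) (simp add: galois_tcomb[OF assms(1)] galois_tcomb[OF assms(2)])
qed

lemma galois_root:
  assumes g: "g \<in> carrier G"
  shows "g \<rho> \<in> {\<rho>, \<rho>1, \<rho>2}"
proof (rule roots)
  have m: "z - w = z + (- 1) * w" for z w :: complex by simp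
  have "g (\<rho> ^ 3 + (- N) * \<rho> ^ 2 + (- (N + 3)) * \<rho> + (- 1)) =
      g \<rho> ^ 3 + (- N) * g \<rho> ^ 2 + (- (N + 3)) * g \<rho> + (- 1)"
    using g by (simp only: galois_hom galois_power K_mem K_add K_mult Rats_minus_iff Rats_add N_Rats
        Rats_1 Rats_number_of)
  moreover have "\<rho> ^ 3 + (- N) * \<rho> ^ 2 + (- (N + 3)) * \<rho> + (- 1) = 0"
    using rootN by (simp add: algebra_simps)
  ultimately show "g \<rho> ^ 3 - N * g \<rho> ^ 2 - (N + 3) * g \<rho> - 1 = 0"
    using galois_hom(1)[OF g, of 0] by (simp add: algebra_simps)
qed

definition \<tau> :: "complex \<Rightarrow> complex" where "\<tau> = compose K \<sigma> \<sigma>"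
definition \<iota> :: "complex \<Rightarrow> complex" where "\<iota> = (\<lambda>z\<in>K. z)"

lemma sigma_apply:
  assumes "k \<in> \<rat>" "x \<in> \<rat>" "y \<in> \<rat>"
  shows "\<sigma> (k + tcomb x y) = k + tcomb (- y) (x - y)"
  unfolding galois_tcomb[OF sigma(1) assms] sigma(2) rho1_root_step
  by (simp add: tcomb_def \<theta>_def \<theta>1_def \<rho>2_def algebra_simps)

lemma tau_apply:
  assumes "k \<in> \<rat>" "x \<in> \<rat>" "y \<in> \<rat>"
  shows "\<tau> (k + tcomb x y) = k + tcomb (y - x) (- x)"
  using assms by (simp add: \<tau>_def compose_def KI sigma_apply)

lemma iota_apply: "z \<in> K \<Longrightarrow> \<iota> z = z"
  by (simp add: \<iota>_def)

lemma tau_rho: "\<tau> \<rho> = \<rho>2"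
proof -
  have "\<tau> (N / 3 + tcomb (1 / 3) 0) = N / 3 + tcomb (- 1 / 3) (- 1 / 3)"
    by (subst tau_apply) auto
  then show ?thesis
    by (subst rho_eq_tcomb) (simp add: tcomb_def \<theta>_def \<theta>1_def \<rho>2_def field_simps)
qed

lemma conj_mem: "\<tau> \<in> carrier G" "\<iota> \<in> carrier G"
proof -
  have s: "\<sigma> \<in> Bij K" using sigma(1) by (simp add: carrier_iff)
  show "\<tau> \<in> carrier G"
    unfolding carrier_iff
  proof (intro conjI ballI Ring.ring_hom_memI)
    show "\<tau> \<in> Bij K" using s by (simp add: \<tau>_def compose_Bij)
  qed (use galois_hom[OF sigma(1)] K_mem(2) in \<open>auto simp: \<tau>_def compose_def K_add K_mult\<close>)
  show "\<iota> \<in> carrier G"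
    unfolding carrier_iff
  proof (intro conjI ballI Ring.ring_hom_memI)
    show "\<iota> \<in> Bij K" by (simp add: \<iota>_def id_Bij)
  qed (use K_mem(2) in \<open>auto simp: \<iota>_def K_add K_mult\<close>)
qed

text \<open>An automorphism permutes the roots of the cubic and is determined by the image of
  \<rho>, so the three images \<open>\<rho>\<close>, \<open>\<rho>1\<close>, \<open>\<rho>2\<close>
  exhaust the group.\<close>

lemma carrier_eq: "carrier G = {\<iota>, \<sigma>, \<tau>}"
proof
  show "carrier G \<subseteq> {\<iota>, \<sigma>, \<tau>}"
  proof
    fix g assume g: "g \<in> carrier G"
    show "g \<in> {\<iota>, \<sigma>, \<tau>}"
      using galois_root[OF g] galois_eqI[OF g] conj_mem sigma tau_rho iota_apply[OF K_mem(1)]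
      by auto
  qed
qed (use conj_mem sigma in auto)

lemma distinct: "\<iota> \<noteq> \<sigma>" "\<iota> \<noteq> \<tau>" "\<sigma> \<noteq> \<tau>"
proof -
  have "\<rho> \<noteq> \<rho>1"
    using lin_indep[of 0 1 "- 1"] by auto
  then show "\<iota> \<noteq> \<sigma>"
    using sigma(2) iota_apply[OF K_mem(1)] by auto
  have "\<rho> \<noteq> \<rho>2"
    using lin_indep[of "- N" 2 1] by (auto simp: \<rho>2_def algebra_simps)
  then show "\<iota> \<noteq> \<tau>"
    using tau_rho iota_apply[OF K_mem(1)] by auto
  have "\<rho>1 \<noteq> \<rho>2"
    using lin_indep[of "- N" 1 2] by (auto simp: \<rho>2_def algebra_simps)
  then show "\<sigma> \<noteq> \<tau>"
    using sigma(2) tau_rho by auto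
qed

lemma group_ring_act_eq:
  "z \<in> K \<Longrightarrow> group_ring_act G x z = x \<iota> * z + x \<sigma> * \<sigma> z + x \<tau> * \<tau> z"
  using distinct by (simp add: group_ring_act_def carrier_eq iota_apply)

lemma group_ring_coeffs:
  assumes "r \<in> R" "s \<in> R" "t \<in> R"
  obtains x where "x \<in> group_ring R G" "x \<iota> = r" "x \<sigma> = s" "x \<tau> = t"
proof
  let ?x = "\<lambda>g\<in>carrier G. if g = \<iota> then r else if g = \<sigma> then s else t"
  show "?x \<in> group_ring R G"
    using assms by (auto simp: group_ring_def)
  show "?x \<iota> = r" "?x \<sigma> = s" "?x \<tau> = t"
    using distinct by (auto simp: carrier_eq)
qed

lemma group_ring_mem: "x \<in> group_ring R G \<Longrightarrow> x \<iota> \<in> R \<and> x \<sigma> \<in> R \<and> x \<tau> \<in> R"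
  by (auto simp: group_ring_def carrier_eq)

end

subsection \<open>The ring of integers\<close>

context shanks_galois
begin

lemma algebraic_int_tcombI:
  assumes P: "3 * of_int \<Delta> * (x ^ 2 - x * y + y ^ 2) \<in> \<int>" and Q: "of_int \<Delta> * cubic_form x y \<in> \<int>"
  shows "algebraic_int (tcomb x y)"
proof -
  define t where "t = tcomb x y"
  define P' where "P' = 3 * of_int \<Delta> * (x ^ 2 - x * y + y ^ 2)"
  define Q' where "Q' = of_int \<Delta> * cubic_form x y"
  \<comment> \<open>The choice k = -t kills the first factor and turns \<open>norm_eq\<close> into
    the characteristic equation of t.\<close>
  have "(- t + tcomb x y) * (- t + tcomb (- y) (x - y)) * (- t + tcomb (y - x) (- x)) = 0"
    by (simp add: t_def)
  then have eq: "(- t) ^ 3 - P' * (- t) + Q' = 0"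
    unfolding norm_eq by (simp add: P'_def Q'_def mult_ac)
  have "algebraic_int t"
  proof (rule algebraic_int.intros)
    show "lead_coeff [:- Q', - P', 0, 1:] = 1" by simp
    show "\<forall>i. coeff [:- Q', - P', 0, 1:] i \<in> \<int>"
      using P Q by (auto simp: coeff_pCons P'_def[symmetric] Q'_def[symmetric] split: nat.split)
    have p: "poly [:- Q', - P', 0, 1:] t = - ((- t) ^ 3 - P' * (- t) + Q')"
      by (simp add: power3_eq_cube algebra_simps)
    show "poly [:- Q', - P', 0, 1:] t = 0"
      unfolding p eq by simp
  qed
  then show ?thesis by (simp add: t_def)
qed

text \<open>The three expressions are the elementary symmetric functions of the conjugates:
  algebraic integers that are rational, hence integers.\<close>

lemma algebraic_int_imp_Ints:
  assumes r: "k \<in> \<rat>" "x \<in> \<rat>" "y \<in> \<rat>" and z: "algebraic_int (k + tcomb x y)"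
  shows "3 * k \<in> \<int>"
    and "3 * k ^ 2 - 3 * of_int \<Delta> * (x ^ 2 - x * y + y ^ 2) \<in> \<int>"
    and "k ^ 3 - 3 * of_int \<Delta> * (x ^ 2 - x * y + y ^ 2) * k + of_int \<Delta> * cubic_form x y \<in> \<int>"
proof -
  define a b c where "a = tcomb x y" and "b = tcomb (- y) (x - y)" and "c = tcomb (y - x) (- x)"
  have A: "algebraic_int (k + a)" using z by (simp add: a_def)
  have B: "algebraic_int (k + b)"
    using galois_algebraic_int[OF sigma(1) KI z] r by (simp add: b_def sigma_apply)
  have C: "algebraic_int (k + c)"
    using galois_algebraic_int[OF conj_mem(1) KI z] r by (simp add: c_def tau_apply)
  note abc = tcomb_sum[of x y, folded a_def b_def c_def] tcomb_sym2[of x y, folded a_def b_def c_def]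
  have "(k + a) + (k + b) + (k + c) = 3 * k + (a + b + c)"
    by simp
  then have "algebraic_int (3 * k)"
    using algebraic_int_plus[OF algebraic_int_plus[OF A B] C] unfolding abc by simp
  then show "3 * k \<in> \<int>"
    using r by (intro rational_algebraic_int_is_int) auto
  have "(k + a) * (k + b) + (k + b) * (k + c) + (k + c) * (k + a) =
      3 * k ^ 2 + 2 * (a + b + c) * k + (a * b + b * c + c * a)"
    by (simp add: power2_eq_square algebra_simps)
  also have "\<dots> = 3 * k ^ 2 - 3 * of_int \<Delta> * (x ^ 2 - x * y + y ^ 2)"
    unfolding abc by simp
  finally have "algebraic_int (3 * k ^ 2 - 3 * of_int \<Delta> * (x ^ 2 - x * y + y ^ 2))"
    by (metis A B C algebraic_int_plus algebraic_int_times)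
  then show "3 * k ^ 2 - 3 * of_int \<Delta> * (x ^ 2 - x * y + y ^ 2) \<in> \<int>"
    using r by (intro rational_algebraic_int_is_int) (auto intro!: Rats_add Rats_diff Rats_mult Rats_power)
  have "algebraic_int ((k + a) * (k + b) * (k + c))"
    by (intro algebraic_int_times A B C)
  then show "k ^ 3 - 3 * of_int \<Delta> * (x ^ 2 - x * y + y ^ 2) * k + of_int \<Delta> * cubic_form x y \<in> \<int>"
    unfolding a_def b_def c_def norm_eq using r cubic_form_Rats
    by (intro rational_algebraic_int_is_int) (auto intro!: Rats_add Rats_diff Rats_mult Rats_power)
qed

text \<open>The element (u / q) \<cdot> \<open>\<theta>\<close>, with numerator and denominator kept
  apart so that divisibility can be discussed in \<open>eis\<close>.\<close>

definition ecomb :: "complex \<Rightarrow> eis \<Rightarrow> complex" where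
  "ecomb q u = tcomb (of_int (re u) / q) (of_int (im u) / q)"

lemma ecomb_0 [simp]: "ecomb q 0 = 0"
  by (simp add: ecomb_def)

lemma ecomb_add: "ecomb q u + ecomb q v = ecomb q (u + v)"
  by (simp add: ecomb_def tcomb_add add_divide_distrib)

lemma ecomb_minus: "- ecomb q u = ecomb q (- u)"
  by (simp add: ecomb_def tcomb_def algebra_simps)

lemma ecomb_of_int_mult: "ecomb q (of_int k * u) = of_int k * ecomb q u"
  by (simp add: ecomb_def tcomb_scale)

lemma ecomb_divide: "ecomb q u / c = ecomb (c * q) u"
  using tcomb_scale[of "1 / c"] by (simp add: ecomb_def mult.commute)

lemma ecomb_K: "q \<in> \<rat> \<Longrightarrow> k \<in> \<rat> \<Longrightarrow> k + ecomb q u \<in> K"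
  unfolding ecomb_def by (intro KI) auto

lemma sigma_ecomb: "q \<in> \<rat> \<Longrightarrow> k \<in> \<rat> \<Longrightarrow> \<sigma> (k + ecomb q u) = k + ecomb q (Eis 0 1 * u)"
  unfolding ecomb_def by (subst sigma_apply) (auto simp: diff_divide_distrib)

lemma tau_ecomb: "q \<in> \<rat> \<Longrightarrow> k \<in> \<rat> \<Longrightarrow> \<tau> (k + ecomb q u) = k + ecomb q (Eis (- 1) (- 1) * u)"
  unfolding ecomb_def by (subst tau_apply) (auto simp: diff_divide_distrib)

lemma ecomb_norm:
  "(of_int (re u) / q) ^ 2 - (of_int (re u) / q) * (of_int (im u) / q) + (of_int (im u) / q) ^ 2
    = of_int (enorm u) / (q ^ 2 :: complex)"
  by (simp add: enorm_def power_divide diff_divide_distrib add_divide_distrib power2_eq_square)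

text \<open>\<open>Eis n (- 3)\<close> is the conjugate of A = n + 3 + 3 \<zeta>.\<close>

lemma ecomb_cubic_form:
  "cubic_form (of_int (re u) / q) (of_int (im u) / q) = of_int (etr (u ^ 3 * Eis n (- 3))) / q ^ 3"
proof -
  define x y where "x = (of_int (re u) :: complex)" and "y = (of_int (im u) :: complex)"
  have "etr (u ^ 3 * Eis n (- 3)) = (2 * n + 3) * (re u ^ 3 + im u ^ 3 - 3 * re u * im u ^ 2)
      + (3 - n) * (3 * re u ^ 2 * im u - 3 * re u * im u ^ 2)"
    by (simp add: etr_def power2_eq_square power3_eq_cube algebra_simps)
  then have eq: "of_int (etr (u ^ 3 * Eis n (- 3))) = (2 * N + 3) * (x ^ 3 + y ^ 3 - 3 * x * y ^ 2)
      + (3 - N) * (3 * x ^ 2 * y - 3 * x * y ^ 2)"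
    by (simp add: x_def y_def N_def)
  have "cubic_form (x * r) (y * r) = ((2 * N + 3) * (x ^ 3 + y ^ 3 - 3 * x * y ^ 2)
      + (3 - N) * (3 * x ^ 2 * y - 3 * x * y ^ 2)) * r ^ 3" for r
    unfolding cubic_form_def by (simp add: power2_eq_square power3_eq_cube algebra_simps)
  from this[of "inverse q"] show ?thesis
    unfolding eq by (simp add: x_def y_def divide_inverse power_inverse)
qed

end

lemma of_int_div_Ints_iff:
  assumes "q \<noteq> 0"
  shows "(of_int a / of_int q :: complex) \<in> \<int> \<longleftrightarrow> q dvd a"
proof
  assume "(of_int a / of_int q :: complex) \<in> \<int>"
  then obtain k where "of_int a / of_int q = (of_int k :: complex)"
    by (elim Ints_cases)
  then have "(of_int a :: complex) = of_int (q * k)"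
    using assms by (simp add: field_simps)
  then have "a = q * k" by (simp only: of_int_eq_iff)
  then show "q dvd a" by simp
qed (use assms in auto)

text \<open>\<open>g\<close> is the denominator \<open>e c\<^sup>2\<close> and \<open>ecomb g a\<close> is \<open>\<alpha>\<close>; the hypotheses compute the
  characteristic polynomial of \<open>u \<cdot> \<alpha>\<close> for \<open>u\<close> in \<open>\<int>[\<zeta>]\<close>.\<close>

locale shanks_integral = shanks_galois +
  fixes a B :: eis and g D :: int
  assumes g: "g > 0" and D: "D > 0" "squarefree D" "coprime D 6"
    and B: "enorm B = D" "\<not> 3 dvd im B"
    and norm_a: "\<Delta> * enorm a = g ^ 2 * D"
    and cube_a: "of_int \<Delta> * a ^ 3 * Eis n (- 3) = of_int (g ^ 3 * D) * B"
begin

abbreviation E :: "eis \<Rightarrow> complex" where "E u \<equiv> ecomb (of_int g) (u * a)"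

lemma form2:
  assumes "k \<noteq> 0"
  shows "3 * of_int \<Delta> * (of_int (enorm (u * a)) / (of_int k * of_int g) ^ 2)
    = (of_int (3 * D * enorm u) / of_int (k ^ 2) :: complex)"
proof -
  have "3 * \<Delta> * enorm (u * a) = g ^ 2 * (3 * D * enorm u)"
    using norm_a by (simp add: enorm_mult mult_ac)
  then have "(of_int (3 * \<Delta> * enorm (u * a)) :: complex) = of_int (g ^ 2 * (3 * D * enorm u))"
    by (simp only:)
  then have "3 * of_int \<Delta> * of_int (enorm (u * a)) = (of_int g ^ 2 * of_int (3 * D * enorm u) :: complex)"
    by (simp only: of_int_mult of_int_power of_int_numeral)
  then have "3 * of_int \<Delta> * (of_int (enorm (u * a)) / (of_int k * of_int g) ^ 2)
      = (of_int g ^ 2 * of_int (3 * D * enorm u) / (of_int k * of_int g) ^ 2 :: complex)"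
    by (simp only: times_divide_eq_right)
  also have "\<dots> = of_int (3 * D * enorm u) / of_int (k ^ 2)"
    using g by (simp add: power_mult_distrib)
  finally show ?thesis .
qed

lemma form3:
  assumes "k \<noteq> 0"
  shows "of_int \<Delta> * (of_int (etr ((u * a) ^ 3 * Eis n (- 3))) / (of_int k * of_int g) ^ 3)
    = (of_int (D * etr (u ^ 3 * B)) / of_int (k ^ 3) :: complex)"
proof -
  have etr_scale: "etr (of_int i * w) = i * etr w" for i w
    by (simp add: etr_def algebra_simps)
  have "of_int \<Delta> * ((u * a) ^ 3 * Eis n (- 3)) = u ^ 3 * (of_int \<Delta> * a ^ 3 * Eis n (- 3))"
    by (simp add: power_mult_distrib mult_ac)
  also have "\<dots> = of_int (g ^ 3 * D) * (u ^ 3 * B)"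
    unfolding cube_a by (simp add: mult_ac)
  finally have "\<Delta> * etr ((u * a) ^ 3 * Eis n (- 3)) = g ^ 3 * (D * etr (u ^ 3 * B))"
    by (metis etr_scale mult.assoc)
  then have "(of_int (\<Delta> * etr ((u * a) ^ 3 * Eis n (- 3))) :: complex) = of_int (g ^ 3 * (D * etr (u ^ 3 * B)))"
    by simp
  then have "of_int \<Delta> * of_int (etr ((u * a) ^ 3 * Eis n (- 3)))
      = (of_int g ^ 3 * of_int (D * etr (u ^ 3 * B)) :: complex)"
    by (simp only: of_int_mult of_int_power)
  then have "of_int \<Delta> * (of_int (etr ((u * a) ^ 3 * Eis n (- 3))) / (of_int k * of_int g) ^ 3)
      = (of_int g ^ 3 * of_int (D * etr (u ^ 3 * B)) / (of_int k * of_int g) ^ 3 :: complex)"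
    by (simp only: times_divide_eq_right)
  also have "\<dots> = of_int (D * etr (u ^ 3 * B)) / of_int (k ^ 3)"
    using g by (simp add: power_mult_distrib)
  finally show ?thesis .
qed

lemma algebraic_int_E: "algebraic_int (E u)"
proof -
  \<comment> \<open>The denominator is written as 1 times g to fit \<open>form2\<close> and
    \<open>form3\<close> with k = 1.\<close>
  have "algebraic_int (ecomb (of_int 1 * of_int g) (u * a))"
    unfolding ecomb_def
    by (rule algebraic_int_tcombI; unfold ecomb_norm ecomb_cubic_form form2[OF one_neq_zero] form3[OF one_neq_zero])
      auto
  then show ?thesis by simp
qed

lemma divide_E_imp_dvd:
  assumes k: "k \<noteq> 0" and alg: "algebraic_int (E u / of_int k)"
  shows "k ^ 2 dvd 3 * D * enorm u" "k ^ 3 dvd D * etr (u ^ 3 * B)"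
proof -
  have "algebraic_int (0 + ecomb (of_int k * of_int g) (u * a))"
    using alg by (simp add: ecomb_divide)
  note I = algebraic_int_imp_Ints[OF _ _ _ this[unfolded ecomb_def], unfolded ecomb_norm ecomb_cubic_form]
  have "of_int (3 * D * enorm u) / of_int (k ^ 2) \<in> (\<int> :: complex set)"
    using I(2) unfolding form2[OF k, symmetric] by simp
  then show "k ^ 2 dvd 3 * D * enorm u"
    by (subst (asm) of_int_div_Ints_iff) (use k in auto)
  have "of_int (D * etr (u ^ 3 * B)) / of_int (k ^ 3) \<in> (\<int> :: complex set)"
    using I(3) unfolding form3[OF k, symmetric] by simp
  then show "k ^ 3 dvd D * etr (u ^ 3 * B)"
    by (subst (asm) of_int_div_Ints_iff) (use k in auto)
qed

lemma prime_dvd_if_algebraic_int: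
  assumes p: "prime (p :: int)" and alg: "algebraic_int (E u / of_int p)"
  shows "of_int p dvd u"
proof (rule eis_dvd_if_integrality_conditions[OF p D(2,3) B])
  have p0: "p \<noteq> 0" using p by auto
  show "p ^ 3 dvd D * etr (u ^ 3 * B)"
    using divide_E_imp_dvd(2)[OF p0 alg] .
  \<comment> \<open>Adding the integral element \<open>E y\<close> to \<open>E u / of_int p\<close>
    preserves integrality, so the norm condition holds for the whole class of u modulo p.\<close>
  show "p ^ 2 dvd 3 * D * enorm (u + of_int p * y)" for y
  proof (rule divide_E_imp_dvd(1)[OF p0])
    have "E (u + of_int p * y) = E u + of_int p * E y"
      by (simp only: ecomb_add[symmetric] ecomb_of_int_mult[symmetric] distrib_right mult.assoc)
    then have "E (u + of_int p * y) / of_int p = E u / of_int p + E y"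
      using p0 by (simp add: add_divide_distrib)
    then show "algebraic_int (E (u + of_int p * y) / of_int p)"
      using algebraic_int_plus[OF alg algebraic_int_E] by simp
  qed
qed

lemma dvd_if_algebraic_int:
  "k > 0 \<Longrightarrow> algebraic_int (E u / of_int (int k)) \<Longrightarrow> of_int (int k) dvd u"
proof (induction k arbitrary: u rule: less_induct)
  case (less k)
  show ?case
  proof (cases "k = 1")
    case False
    then obtain p where p: "prime p" "p dvd k"
      using prime_factor_nat by blast
    then obtain j where j: "k = p * j" by (elim dvdE)
    have jk: "j < k" "j > 0" and p0: "p > 0"
      using less.prems(1) p(1) prime_gt_1_nat[of p] by (auto simp: j)
    have "algebraic_int (of_int (int j) * (E u / of_int (int k)))"
      by (intro algebraic_int_times less.prems(2)) (auto intro: int_imp_algebraic_int)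
    also have "of_int (int j) * (E u / of_int (int k)) = E u / of_int (int p)"
      using jk p0 by (simp add: j)
    finally have "of_int (int p) dvd u"
      using p(1) by (intro prime_dvd_if_algebraic_int) auto
    then obtain v where v: "u = of_int (int p) * v" by (elim dvdE)
    have "E u / of_int (int k) = E v / of_int (int j)"
      unfolding v mult.assoc ecomb_of_int_mult using jk p0 by (simp add: j)
    then have "of_int (int j) dvd v"
      using less.IH[of j v] jk less.prems(2) by simp
    then show ?thesis
      using mult_dvd_mono[OF dvd_refl[of "of_int (int p)"]] by (simp add: v j)
  qed simp
qed

text \<open>Division by a is multiplication by its conjugate over the positive integer N(a); the
  common denominator then goes into k.\<close>

lemma tcomb_eq_E_divide:
  assumes "x \<in> \<rat>" "y \<in> \<rat>"
  obtains u k where "k > 0" "tcomb x y = E u / of_int (int k)"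
proof -
  obtain x1 m where x: "m > 0" "x = of_int x1 / of_int m"
    using assms(1) by (rule Rats_cases')
  obtain y1 l where y: "l > 0" "y = of_int y1 / of_int l"
    using assms(2) by (rule Rats_cases')
  define M where "M = enorm a"
  have "g ^ 2 * D > 0" using g D by simp
  then have "\<Delta> * M > 0" using norm_a by (simp add: M_def)
  moreover have "M \<ge> 0"
  proof -
    have "4 * M = (2 * re a - im a) ^ 2 + 3 * im a ^ 2"
      by (simp add: M_def enorm_def power2_eq_square algebra_simps)
    moreover have "\<dots> \<ge> 0" by simp
    ultimately show ?thesis by linarith
  qed
  ultimately have M: "M > 0" by (cases "M = 0") auto
  define w where "w = Eis (x1 * l) (y1 * m)"
  define u where "u = of_int g * (w * ecnj a)"
  define k where "k = nat (m * l * M)"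
  have mlM: "m * l * M > 0" using x(1) y(1) M by simp
  then have k: "int k = m * l * M" "k > 0"
    by (simp_all add: k_def)
  have "u * a = of_int g * w * (a * ecnj a)"
    by (simp add: u_def mult_ac)
  also have "\<dots> = of_int (g * M) * w"
    unfolding mult_ecnj by (simp add: M_def mult_ac)
  finally have "u * a = of_int (g * M) * w" .
  then have "E u / of_int (int k) = tcomb x y"
    using x y M g unfolding k(1) ecomb_divide
    by (simp add: ecomb_def w_def)
  with k(2) that show ?thesis by metis
qed

text \<open>Three times the rational part is the trace, so a priori z = h / 3 + \<open>E u\<close> /
  3 with h an integer. Showing 3 | h makes the second summand integral by itself, and then 3 |
  u.\<close>

lemma ring_of_integers_eq: "ring_of_integers K = {of_int k + E u |k u. True}"
proof
  show "{of_int k + E u |k u. True} \<subseteq> ring_of_integers K"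
    using algebraic_int_E
    by (auto simp: ring_of_integers_def intro!: ecomb_K algebraic_int_plus intro: int_imp_algebraic_int)
next
  show "ring_of_integers K \<subseteq> {of_int k + E u |k u. True}"
  proof
    fix z assume "z \<in> ring_of_integers K"
    then have zK: "z \<in> K" and z: "algebraic_int z"
      by (simp_all add: ring_of_integers_def)
    obtain k x y where r: "k \<in> \<rat>" "x \<in> \<rat>" "y \<in> \<rat>" and z_eq: "z = k + tcomb x y"
      using zK by (rule KE)
    have "3 * k \<in> \<int>"
      using algebraic_int_imp_Ints(1)[OF r] z by (simp add: z_eq)
    then obtain h where h: "3 * k = of_int h" by (elim Ints_cases)
    have num: "algebraic_int (of_int i :: complex)" for i
      by (rule int_imp_algebraic_int) simp
    obtain w m where m: "m > 0" and w: "tcomb (3 * x) (3 * y) = E w / of_int (int m)"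
      using tcomb_eq_E_divide[OF Rats_mult Rats_mult] r by (metis Rats_number_of)
    have z3: "of_int 3 * z + of_int (- h) = tcomb (3 * x) (3 * y)"
      by (simp add: z_eq distrib_left h tcomb_scale)
    have "algebraic_int (of_int 3 * z + of_int (- h))"
      by (intro algebraic_int_plus algebraic_int_times num z)
    then have "of_int (int m) dvd w"
      unfolding z3 w using m by (intro dvd_if_algebraic_int)
    then obtain u where "w = of_int (int m) * u" by (elim dvdE)
    then have u: "tcomb (3 * x) (3 * y) = E u"
      using m unfolding w by (simp add: mult.assoc ecomb_of_int_mult del: of_int_of_nat_eq)
    have k3: "k = of_int h / of_int 3" by (simp flip: h)
    have xy: "tcomb x y = E u / of_int 3"
      using u tcomb_scale[of 3 x y] by (simp add: field_simps)
    have "3 dvd h"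
    proof -
      have three: "(3 :: int) \<noteq> 0" by simp
      have q: "of_int 3 * of_int g \<in> (\<rat> :: complex set)" by simp
      have zE: "z = k + ecomb (of_int 3 * of_int g) (u * a)"
        by (simp add: z_eq xy ecomb_divide)
      \<comment> \<open>\<sigma> z - z has no rational part and equals \<open>E\<close> of (\<zeta>
        - 1) u, divided by 3. Hence 3 | (\<zeta> - 1) u, so that 1 - \<zeta> divides u.\<close>
      have "algebraic_int (\<sigma> z)"
        using galois_algebraic_int[OF sigma(1) zK z] .
      then have "algebraic_int (\<sigma> z + of_int (- 1) * z)"
        by (intro algebraic_int_plus algebraic_int_times num z)
      also have "\<sigma> z + of_int (- 1) * z = ecomb (of_int 3 * of_int g) (Eis 0 1 * (u * a)) - ecomb (of_int 3 * of_int g) (u * a)"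
        unfolding zE sigma_ecomb[OF q r(1)] by simp
      also have "\<dots> = ecomb (of_int 3 * of_int g) (Eis 0 1 * (u * a) + - (u * a))"
        by (simp only: ecomb_add[symmetric] ecomb_minus[symmetric]) simp
      also have "Eis 0 1 * (u * a) + - (u * a) = (Eis (- 1) 1 * u) * a"
        by (simp add: eis_eq_iff algebra_simps)
      finally have "algebraic_int (E (Eis (- 1) 1 * u) / of_int 3)"
        by (simp add: ecomb_divide)
      then have "of_int 3 dvd Eis (- 1) 1 * u"
        by (intro prime_dvd_if_algebraic_int) simp_all
      then have "3 dvd - re u - im u"
        unfolding of_int_dvd_eis_iff by simp
      then have "3 dvd enorm u"
        unfolding three_dvd_enorm_iff by (metis dvd_minus_iff minus_add_distrib uminus_add_conv_diff add.commute)
      then obtain v where v: "u = Eis 1 (- 1) * v" by (rule eis_dvd_lambda)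
      have "algebraic_int (k + ecomb (of_int 3 * of_int g) (u * a))"
        using z zE by simp
      \<comment> \<open>The norm of z is now used. With u = (1 - \<zeta>) v, the terms of its
        numerator other than h^3 are divisible by 9, so 9 | h^3.\<close>
      note I = algebraic_int_imp_Ints(3)[OF r(1) _ _ this[unfolded ecomb_def], unfolded ecomb_norm ecomb_cubic_form]
      have "k ^ 3 - (3 * of_int \<Delta> * (of_int (enorm (u * a)) / (of_int 3 * of_int g) ^ 2)) * k
          + of_int \<Delta> * (of_int (etr ((u * a) ^ 3 * Eis n (- 3))) / (of_int 3 * of_int g) ^ 3) \<in> \<int>"
        using I by simp
      then have "of_int h ^ 3 / 27 - of_int (3 * D * enorm u) / 9 * (of_int h / 3)
          + of_int (D * etr (u ^ 3 * B)) / 27 \<in> (\<int> :: complex set)"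
        unfolding form2[OF three] form3[OF three] k3
        by (simp add: power_divide)
      moreover have "of_int h ^ 3 / 27 - of_int (3 * D * enorm u) / 9 * (of_int h / 3)
          + of_int (D * etr (u ^ 3 * B)) / 27
          = (of_int (h ^ 3 - 3 * D * enorm u * h + D * etr (u ^ 3 * B)) / of_int 27 :: complex)"
        by (simp add: diff_divide_distrib add_divide_distrib)
      ultimately have "(of_int (h ^ 3 - 3 * D * enorm u * h + D * etr (u ^ 3 * B)) / of_int 27 :: complex) \<in> \<int>"
        by (simp only:)
      then have "27 dvd h ^ 3 - 3 * D * enorm u * h + D * etr (u ^ 3 * B)"
        by (subst (asm) of_int_div_Ints_iff) simp
      moreover have "enorm u = 3 * enorm v"
        by (simp add: v enorm_mult) (simp add: enorm_def)
      moreover have "etr (u ^ 3 * B) = 9 * im (v ^ 3 * B)"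
      proof -
        have "u ^ 3 = 3 * Eis (- 1) (- 2) * v ^ 3"
          by (simp add: v power_mult_distrib) (simp add: eis_eq_iff power3_eq_cube)
        then show ?thesis
          by (simp add: etr_def algebra_simps)
      qed
      ultimately have "27 dvd h ^ 3 - 9 * (D * enorm v * h) + 9 * (D * im (v ^ 3 * B))"
        by (simp add: mult_ac)
      then have "9 dvd h ^ 3 - 9 * (D * enorm v * h) + 9 * (D * im (v ^ 3 * B))"
        by (rule dvd_trans[rotated]) simp
      then have "9 dvd h ^ 3" by presburger
      then have "3 dvd h ^ 3" by presburger
      then show "3 dvd h" by (simp add: prime_dvd_power_iff)
    qed
    then obtain j where j: "h = 3 * j" by (elim dvdE)
    have kj: "k = of_int j" using k3 j by simp
    have "E u / of_int 3 = z + of_int (- j)"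
      by (simp add: z_eq xy kj)
    then have "algebraic_int (E u / of_int 3)"
      using algebraic_int_plus[OF z num[of "- j"]] by simp
    then have "of_int 3 dvd u"
      by (intro prime_dvd_if_algebraic_int) simp_all
    then obtain v where v: "u = of_int 3 * v" by (elim dvdE)
    have "E u / of_int 3 = E v"
      unfolding v mult.assoc ecomb_of_int_mult by simp
    then have "z = of_int j + E v"
      by (simp add: z_eq xy kj)
    then show "z \<in> {of_int k + E u |k u. True}" by blast
  qed
qed

end

subsection \<open>Galois module structure\<close>

lemma int_adjoin_zeta:
  assumes z: "\<zeta> ^ 2 + \<zeta> + 1 = 0" and x: "x \<in> int_adjoin \<zeta>"
  obtains b where "x = of_int (re b) + of_int (im b) * \<zeta>"
proof -
  define ev where "ev b = of_int (re b) + of_int (im b) * \<zeta>" for b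
  have sq: "\<zeta> * \<zeta> = - \<zeta> - 1"
    using z by (simp add: power2_eq_square eq_neg_iff_add_eq_0 algebra_simps)
  have ev_mult: "ev (b * c) = ev b * ev c" for b c
  proof -
    have "ev b * ev c = of_int (re b * re c) + of_int (re b * im c + im b * re c) * \<zeta>
        + of_int (im b * im c) * (\<zeta> * \<zeta>)"
      by (simp add: ev_def algebra_simps)
    also have "\<dots> = ev (b * c)"
      unfolding sq by (simp add: ev_def algebra_simps)
    finally show ?thesis by simp
  qed
  have "x \<in> range ev"
    using x unfolding int_adjoin_def
  proof (induction rule: generate_ring.induct)
    case one
    have "ev 1 = 1" by (simp add: ev_def)
    then show ?case by (metis one_complex_on rangeI)
  next
    case (incl h)
    have "ev (Eis 0 1) = \<zeta>" by (simp add: ev_def)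
    with incl show ?case by (metis rangeI singletonD)
  next
    case (a_inv h)
    then obtain b where "h = ev b" by blast
    then have "- h = ev (- b)" by (simp add: ev_def)
    then show ?case by (simp add: a_inv_complex_on)
  next
    case (eng_add h1 h2)
    then obtain b c where "h1 = ev b" "h2 = ev c" by blast
    then have "h1 + h2 = ev (b + c)" by (simp add: ev_def algebra_simps)
    then show ?case by simp
  next
    case (eng_mult h1 h2)
    then obtain b c where "h1 = ev b" "h2 = ev c" by blast
    then have "h1 * h2 = ev (b * c)" by (simp add: ev_mult)
    then show ?case by simp
  qed
  then show ?thesis
    using that by (auto simp: ev_def)
qed

lemma zeta_not_real:
  assumes "\<zeta> ^ 2 + \<zeta> + 1 = 0"
  shows "Im \<zeta> \<noteq> 0"
proof
  assume "Im \<zeta> = 0"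
  then have "Re \<zeta> ^ 2 + Re \<zeta> + 1 = 0"
    using arg_cong[OF assms, of Re] by (simp add: power2_eq_square)
  moreover have "Re \<zeta> ^ 2 + Re \<zeta> + 1 = (Re \<zeta> + 1 / 2) ^ 2 + 3 / 4"
    by (simp add: power2_eq_square algebra_simps)
  moreover have "(Re \<zeta> + 1 / 2) ^ 2 \<ge> 0" by simp
  ultimately show False by linarith
qed

text \<open>Coordinates may be compared because \<zeta> is not real; this serves both primitive cube
  roots of unity alike.\<close>

lemma zeta_divides_imp_eis:
  assumes z: "\<zeta> ^ 3 = 1" "\<zeta> \<noteq> 1"
    and dvd: "(of_int a0 + of_int a1 * \<zeta>) divides\<^bsub>complex_on (int_adjoin \<zeta>)\<^esub> (of_int u + of_int v * \<zeta>)"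
  obtains b where "Eis a0 a1 * b = Eis u v"
proof -
  have "(\<zeta> - 1) * (\<zeta> ^ 2 + \<zeta> + 1) = 0"
    using z(1) by (simp add: power2_eq_square power3_eq_cube algebra_simps)
  then have z2: "\<zeta> ^ 2 + \<zeta> + 1 = 0"
    using z(2) by simp
  obtain x where x: "x \<in> int_adjoin \<zeta>" "of_int u + of_int v * \<zeta> = (of_int a0 + of_int a1 * \<zeta>) * x"
    using dvd by (auto simp: factor_def)
  obtain b where b: "x = of_int (re b) + of_int (im b) * \<zeta>"
    using int_adjoin_zeta[OF z2 x(1)] .
  define w where "w = Eis a0 a1 * b"
  have sq: "\<zeta> * \<zeta> = - \<zeta> - 1"
    using z2 by (simp add: power2_eq_square eq_neg_iff_add_eq_0 algebra_simps)
  have "(of_int a0 + of_int a1 * \<zeta>) * x = of_int (a0 * re b) + of_int (a0 * im b + a1 * re b) * \<zeta>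
      + of_int (a1 * im b) * (\<zeta> * \<zeta>)"
    by (simp add: b algebra_simps)
  also have "\<dots> = of_int (re w) + of_int (im w) * \<zeta>"
    unfolding sq by (simp add: w_def algebra_simps)
  finally have eq: "of_int u + of_int v * \<zeta> = of_int (re w) + of_int (im w) * \<zeta>"
    using x(2) by simp
  have "of_int v * Im \<zeta> = of_int (im w) * Im \<zeta>"
    using arg_cong[OF eq, of Im] by simp
  then have v: "v = im w"
    using zeta_not_real[OF z2] by simp
  then have "u = re w"
    using eq by simp
  with v have "Eis a0 a1 * b = Eis u v"
    by (simp add: eis_eq_iff w_def)
  then show ?thesis by (rule that)
qed

text \<open>S is an arbitrary set here, so no group structure is at hand and the inverse is
  evaluated from its description.\<close>

lemma a_inv_complex_on_subgroup:
  assumes "x \<in> S" "- x \<in> S"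
  shows "inv\<^bsub>add_monoid (complex_on S)\<^esub> x = - x"
proof -
  have "(THE y. y \<in> S \<and> x + y = 0 \<and> y + x = 0) = - x"
  proof (rule the_equality)
    show "y = - x" if "y \<in> S \<and> x + y = 0 \<and> y + x = 0" for y
      using that minus_unique by metis
  qed (use assms in simp)
  then show ?thesis
    by (simp add: m_inv_def)
qed

lemma additive_subgroup_complex_on:
  assumes "H \<subseteq> S" "0 \<in> H" "\<And>x y. x \<in> H \<Longrightarrow> y \<in> H \<Longrightarrow> x + y \<in> H" "\<And>x. x \<in> H \<Longrightarrow> - x \<in> H"
  shows "additive_subgroup H (complex_on S)"
proof (intro additive_subgroup.intro subgroup.intro)
  fix x assume "x \<in> H"
  moreover from this have "inv\<^bsub>add_monoid (complex_on S)\<^esub> x = - x"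
    using assms by (intro a_inv_complex_on_subgroup) auto
  ultimately show "inv\<^bsub>add_monoid (complex_on S)\<^esub> x \<in> H"
    using assms(4) by simp
qed (use assms in auto)

context shanks_integral
begin

lemma E_add: "E u + E v = E (u + v)"
  by (simp add: ecomb_add distrib_right)

lemma E_uminus: "- E u = E (- u)"
  by (simp add: ecomb_minus)

lemma E_of_int: "of_int k * E u = E (of_int k * u)"
  by (simp add: ecomb_of_int_mult mult.assoc)

lemma E_0: "E 0 = 0"
  by simp

lemma sigma_E: "\<sigma> (of_int k + E u) = of_int k + E (Eis 0 1 * u)"
  by (simp add: sigma_ecomb mult.assoc)

lemma tau_E: "\<tau> (of_int k + E u) = of_int k + E (Eis (- 1) (- 1) * u)"
  by (simp add: tau_ecomb mult.assoc)

lemma E_mem_K: "of_int k + E u \<in> K"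
  by (rule ecomb_K) auto

lemma act_E:
  "group_ring_act G x (of_int k + E u) = (x \<iota> + x \<sigma> + x \<tau>) * of_int k
    + (x \<iota> * E u + x \<sigma> * E (Eis 0 1 * u) + x \<tau> * E (Eis (- 1) (- 1) * u))"
  unfolding group_ring_act_eq[OF E_mem_K] sigma_E tau_E by (simp add: algebra_simps)

text \<open>The integral group ring acts on \<alpha> through Z[\<zeta>], with \<sigma> acting as
  \<zeta> and \<tau> as -1 - \<zeta>. Since 1 and \<zeta> span, coefficient 0 at \<tau> suffices for
  surjectivity.\<close>

lemma int_group_ring_orbit: "(\<lambda>x. group_ring_act G x (E 1)) ` group_ring \<int> G = range E"
proof
  show "(\<lambda>x. group_ring_act G x (E 1)) ` group_ring \<int> G \<subseteq> range E"
  proof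
    fix z assume "z \<in> (\<lambda>x. group_ring_act G x (E 1)) ` group_ring \<int> G"
    then obtain x where x: "x \<in> group_ring \<int> G" and z: "z = group_ring_act G x (E 1)" by blast
    obtain r s t where rst: "x \<iota> = of_int r" "x \<sigma> = of_int s" "x \<tau> = of_int t"
      using group_ring_mem[OF x] by (auto elim!: Ints_cases)
    have "z = E (of_int r * 1 + of_int s * (Eis 0 1 * 1) + of_int t * (Eis (- 1) (- 1) * 1))"
      using act_E[of x 0 1] unfolding z rst E_add[symmetric] E_of_int[symmetric] by simp
    then show "z \<in> range E" by blast
  qed
next
  show "range E \<subseteq> (\<lambda>x. group_ring_act G x (E 1)) ` group_ring \<int> G"
  proof
    fix z assume "z \<in> range E"
    then obtain u where z: "z = E u" by blast
    obtain x where x: "x \<in> group_ring \<int> G" "x \<iota> = of_int (re u)" "x \<sigma> = of_int (im u)" "x \<tau> = 0"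
      using group_ring_coeffs[of "of_int (re u)" \<int> "of_int (im u)" 0] by auto
    have "group_ring_act G x (E 1) = E (of_int (re u) * 1 + of_int (im u) * (Eis 0 1 * 1))"
      using act_E[of x 0 1] unfolding x(2-4) E_add[symmetric] E_of_int[symmetric] by simp
    also have "of_int (re u) * 1 + of_int (im u) * (Eis 0 1 * 1) = u"
      by (simp add: eis_eq_iff)
    finally have "z = group_ring_act G x (E 1)"
      using z by simp
    then show "z \<in> (\<lambda>x. group_ring_act G x (E 1)) ` group_ring \<int> G"
      using x(1) by blast
  qed
qed

lemma int_inter_range_E: "range E \<inter> \<int> = {0}"
proof
  show "range E \<inter> \<int> \<subseteq> {0}"
  proof
    fix z assume "z \<in> range E \<inter> \<int>"
    then obtain u k where "z = E u" "z = of_int k" by (auto elim!: Ints_cases)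
    then have "of_int (- k) + ecomb (of_int g) (u * a) = 0" by simp
    then have "of_int (- k) = (0 :: complex)"
      unfolding ecomb_def by (rule K_indep(1)[rotated 3]) auto
    with \<open>z = of_int k\<close> show "z \<in> {0}" by simp
  qed
  show "{0} \<subseteq> range E \<inter> \<int>"
    using E_0 by (metis Int_iff Ints_0 empty_subsetI insert_subset rangeI)
qed

lemma direct_sum: "internal_direct_sum (complex_on (ring_of_integers K)) (range E) \<int>"
  unfolding internal_direct_sum_def
proof (intro conjI)
  have "z \<in> ring_of_integers K" if "z = of_int k + E u" for z k u
    using that unfolding ring_of_integers_eq by blast
  from this[of _ 0] this[of _ _ 0] have sub: "range E \<subseteq> ring_of_integers K" "\<int> \<subseteq> ring_of_integers K"
    unfolding E_0 by (auto elim!: Ints_cases)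
  show "additive_subgroup (range E) (complex_on (ring_of_integers K))"
  proof (rule additive_subgroup_complex_on[OF sub(1)])
    show "0 \<in> range E" using E_0 by (metis rangeI)
    show "x + y \<in> range E" if xy: "x \<in> range E" "y \<in> range E" for x y
    proof -
      obtain u v where "x = E u" "y = E v"
        using xy by blast
      then have "x + y = E (u + v)"
        by (simp only: E_add)
      then show ?thesis by blast
    qed
    show "- x \<in> range E" if x: "x \<in> range E" for x
    proof -
      obtain u where "x = E u"
        using x by blast
      then have "- x = E (- u)"
        by (simp only: E_uminus)
      then show ?thesis by blast
    qed
  qed
  show "additive_subgroup \<int> (complex_on (ring_of_integers K))"
    by (rule additive_subgroup_complex_on[OF sub(2)]) auto
  show "carrier (complex_on (ring_of_integers K)) = range E <+>\<^bsub>complex_on (ring_of_integers K)\<^esub> \<int>"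
    unfolding ring_of_integers_eq
    by (auto simp: set_add_def set_mult_def add.commute elim!: Ints_cases; metis Ints_of_int add.commute rangeI)
  show "range E \<inter> \<int> = {\<zero>\<^bsub>complex_on (ring_of_integers K)\<^esub>}"
    using int_inter_range_E by simp
qed

text \<open>The associated order contains the idempotent \<open>(1 + \<sigma> + \<sigma>\<^sup>2) / 3\<close>, which kills \<open>\<alpha>\<close> and
  fixes \<open>1\<close>; so it separates the two summands of \<open>\<alpha> + 1\<close>.\<close>

lemma associated_order_orbit:
  "ring_of_integers K = (\<lambda>x. group_ring_act G x (E 1 + 1)) ` associated_order K"
proof
  show "(\<lambda>x. group_ring_act G x (E 1 + 1)) ` associated_order K \<subseteq> ring_of_integers K"
  proof -
    have "E 1 + 1 = of_int 1 + E 1" by simp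
    then have "E 1 + 1 \<in> ring_of_integers K"
      unfolding ring_of_integers_eq by blast
    then show ?thesis
      unfolding associated_order_def G[symmetric] by blast
  qed
next
  show "ring_of_integers K \<subseteq> (\<lambda>x. group_ring_act G x (E 1 + 1)) ` associated_order K"
  proof
    fix z assume "z \<in> ring_of_integers K"
    then obtain k u where z: "z = of_int k + E u"
      unfolding ring_of_integers_eq by blast
    \<comment> \<open>The three coefficients of x must add up to k. Adding i to each of them changes
      only the action on the rational part, as 1 + \<sigma> + \<tau> kills every
      \<open>E v\<close>.\<close>
    define i :: complex where "i = of_int (k - re u - im u) / 3"
    have "i \<in> \<rat>" by (simp add: i_def)
    then obtain x where x: "x \<in> group_ring \<rat> G" "x \<iota> = of_int (re u) + i" "x \<sigma> = of_int (im u) + i" "x \<tau> = i"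
      using group_ring_coeffs[of "of_int (re u) + i" \<rat> "of_int (im u) + i" i] by auto
    \<comment> \<open>Thus x acts as k on the integers and as u on \<open>range E\<close>; it
      preserves the ring of integers and sends \<alpha> + 1 to z.\<close>
    have act: "group_ring_act G x (of_int j + E v) = of_int (k * j) + E (u * v)" for j v
    proof -
      have "v + Eis 0 1 * v + Eis (- 1) (- 1) * v = 0"
        by (simp add: eis_eq_iff)
      then have tr: "E v + E (Eis 0 1 * v) + E (Eis (- 1) (- 1) * v) = 0"
        unfolding E_add by simp
      have "group_ring_act G x (of_int j + E v) = (of_int (re u) + of_int (im u) + 3 * i) * of_int j
          + (of_int (re u) * E v + of_int (im u) * E (Eis 0 1 * v))
          + i * (E v + E (Eis 0 1 * v) + E (Eis (- 1) (- 1) * v))"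
        unfolding act_E x(2-4) by (simp add: distrib_left distrib_right)
      also have "of_int (re u) + of_int (im u) + 3 * i = of_int k"
        by (simp add: i_def)
      finally have "group_ring_act G x (of_int j + E v) = of_int (k * j)
          + (of_int (re u) * E v + of_int (im u) * E (Eis 0 1 * v))
          + i * (E v + E (Eis 0 1 * v) + E (Eis (- 1) (- 1) * v))"
        by simp
      also have "\<dots> = of_int (k * j) + E (of_int (re u) * v + of_int (im u) * (Eis 0 1 * v))"
        unfolding tr E_add[symmetric] E_of_int by simp
      also have "of_int (re u) * v + of_int (im u) * (Eis 0 1 * v) = u * v"
        by (simp add: eis_eq_iff algebra_simps)
      finally show ?thesis .
    qed
    have "x \<in> associated_order K"
      unfolding associated_order_def G[symmetric]
    proof (intro CollectI conjI x(1) image_subsetI)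
      fix w assume "w \<in> ring_of_integers K"
      then obtain j v where "w = of_int j + E v"
        unfolding ring_of_integers_eq by blast
      then show "group_ring_act G x w \<in> ring_of_integers K"
        unfolding ring_of_integers_eq using act by blast
    qed
    moreover have "z = group_ring_act G x (E 1 + 1)"
      using act[of 1 1] by (simp add: z add.commute)
    ultimately show "z \<in> (\<lambda>x. group_ring_act G x (E 1 + 1)) ` associated_order K"
      by blast
  qed
qed

end

theorem theorem3:
  fixes n d e c a0 a1 :: int
    and \<rho> \<rho>' \<zeta> A \<alpha> :: complex
    and L :: "complex set"
    and G :: "(complex \<Rightarrow> complex) monoid"
    and \<sigma> :: "complex \<Rightarrow> complex"
  assumes "3 dvd n" and "\<not> [n = 12] (mod 27)"
    and "\<rho> ^ 3 - of_int n * \<rho> ^ 2 - of_int (n + 3) * \<rho> - 1 = 0"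
    and "L = rat_adjoin \<rho>"
    and "G = galois_group \<rat> L"
    and "\<sigma> \<in> carrier G" and "generate G {\<sigma>} = carrier G"
    and "\<sigma> \<rho> = - 1 / (1 + \<rho>)"
    and "\<rho>' = \<sigma> \<rho>"
    and "d > 0" and "e > 0" and "c > 0"
    and "n ^ 2 + 3 * n + 9 = d * e ^ 2 * c ^ 3"
    and "squarefree d" and "squarefree e" and "coprime d e"
    and "\<zeta> ^ 3 = 1" and "\<zeta> \<noteq> 1"
    and "A = of_int n + 3 * (1 + \<zeta>)"
    and "[n = 3] (mod 9) \<and> \<not> [n = 12] (mod 27) \<longrightarrow> e * c = a0 ^ 2 - a0 * a1 + a1 ^ 2"
    and "[n = 0] (mod 9) \<or> [n = 6] (mod 9) \<longrightarrow> e * c = 3 * (a0 ^ 2 - a0 * a1 + a1 ^ 2)"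
    and "(of_int a0 + of_int a1 * \<zeta>) divides\<^bsub>complex_on (int_adjoin \<zeta>)\<^esub> A"
    and "\<alpha> = 1 / of_int (e * c ^ 2) *
               (3 * of_int a0 * \<rho> + 3 * of_int a1 * \<rho>' - of_int n * of_int (a0 + a1))"
  shows "internal_direct_sum (complex_on (ring_of_integers L))
           ((\<lambda>x. group_ring_act G x \<alpha>) ` group_ring \<int> G) \<int> \<and>
         ring_of_integers L = (\<lambda>x. group_ring_act G x (\<alpha> + 1)) ` associated_order L"
proof -
  interpret shanks_cubic n \<rho>
    using assms(3) by unfold_locales
  have L: "L = K"
    using assms(4) rat_adjoin_eq by simp
  interpret shanks_galois n \<rho> G \<sigma>
    using assms(5,6,8) by unfold_locales (simp_all add: L rho1_eq)
  have "A = of_int (n + 3) + of_int 3 * \<zeta>"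
    using assms(19) by (simp add: algebra_simps)
  then obtain b where b: "Eis a0 a1 * b = Eis (n + 3) 3"
    using zeta_divides_imp_eis[OF assms(17,18)] assms(22) by blast
  have Na: "enorm (Eis a0 a1) = a0 ^ 2 - a0 * a1 + a1 ^ 2"
    by (simp add: enorm_def)
  obtain D B where DB: "D > 0" "squarefree D" "coprime D 6" "enorm B = D" "\<not> 3 dvd im B"
    "(n ^ 2 + 3 * n + 9) * enorm (Eis a0 a1) = (e * c ^ 2) ^ 2 * D"
    "of_int (n ^ 2 + 3 * n + 9) * Eis a0 a1 ^ 3 * Eis n (-3) = of_int ((e * c ^ 2) ^ 3 * D) * B"
    using simplest_cubic_data[OF assms(1,2,10,11,12,13,14,15,16) _ _ b] assms(2,20,21)
    unfolding Na by blast
  interpret shanks_integral n \<rho> G \<sigma> "Eis a0 a1" B "e * c ^ 2" D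
    using DB assms(11,12) by unfold_locales (simp_all add: \<Delta>_def)
  \<comment> \<open>The bracket in the definition of \<alpha> is a0 \<open>\<theta>\<close> + a1
    \<open>\<theta>1\<close>.\<close>
  have "\<alpha> = E 1"
    using assms(8,9,23) rho1_eq
    by (simp add: ecomb_def tcomb_def \<theta>_def \<theta>1_def N_def add_divide_distrib diff_divide_distrib algebra_simps)
  then show ?thesis
    using direct_sum associated_order_orbit int_group_ring_orbit unfolding L by simp
qed

end
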